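(* Let $K$ be a commutative ring with $1\neq 0$, $(A,\theta)$ an independence alphabet and $(B,Z)$ a partition of $A$ (i.e. $A$ is the disjoint union of $B$ and $Z$). Let $\tau_Z(B)=\{[\dots[[z,b_1],b_2],\dots,b_n]\mid z\in Z,\ b_1,\dots,b_n\in B,\ n\ge0,\ zb_1\cdots b_n\in\beta_Z(B)\}\subset L_K(A,\theta)$ and let $J$ be the Lie subalgebra of $L_K(A,\theta)$ generated by $\tau_Z(B)$. (i) $J$ is a Lie ideal of $L_K(A,\theta)$ and $L_K(A,\theta)=L_K(B,\theta_B)\oplus J$ (direct sum of $K$-modules). (ii) If $B$ is a TFSA of $(A,\theta)$, then $J$ is a free partially commutative Lie algebra. (iii) Conversely, if $J$ is a free partially commutative Lie algebra with code $\tau_Z(B)$, then $B$ is a TFSA of $(A,\theta)$.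
   Context: An independence alphabet $(A,\theta)$ is a set $A$ with a symmetric, antireflexive relation $\theta\subset A\times A$. $M(A,\theta)=\langle A\mid ab=ba,\ (a,b)\in\theta\rangle$ is the free partially commutative monoid; its elements are called traces. $\mathrm{Alph}(t)$ is the set of letters occurring in $t$, and $IA(t)=\{a\in A\mid t=aw \text{ for some } w\in M(A,\theta)\}$. For $X\subset M(A,\theta)$, $\langle X\rangle$ is the submonoid generated by $X$ and $\theta_X=\{(x_1,x_2)\in X^2\mid \mathrm{Alph}(x_1)\times\mathrm{Alph}(x_2)\subset\theta\}$. For $B\subset A$, $M(B,\theta_B)$ is identified with the submonoid generated by $B$. $X$ is a partially commutative code if the natural morphism $M(X,\theta_X)\to\langle X\rangle$ is an isomorphism. For $B\subset A$ and $Z=A\setminus B$, $\beta_Z(B)=\{zw\mid z\in Z,\ w\in M(B,\theta_B),\ IA(zw)=\{z\}\}$; $B$ is a transitively factorizing subalphabet (TFSA) of $(A,\theta)$ if $\beta_Z(B)$ is a partially commutative code. $K\langle A,\theta\rangle=K[M(A,\theta)]$ is the monoid algebra with the bracket $[x,y]=xy-yx$, and $L_K(A,\theta)$ is its Lie subalgebra generated by the letters $A$; equivalently it is the quotient of the free Lie algebra $L_K(A)$ by the Lie ideal generated by the $[a,b]$, $(a,b)\in\theta$. $L_K(B,\theta_B)$ is identified with the Lie subalgebra generated by $B$. A Lie algebra is free partially commutative if it is isomorphic to some $L_K(X,\vartheta)$ with $(X,\vartheta)$ an independence alphabet; it is free partially commutative with code a subset $X$ if, for some independence relation $\vartheta$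 on $X$, the inclusion of $X$ extends to an isomorphism from $L_K(X,\vartheta)$ onto it. *)

theory Defs
  imports Complex_Main "HOL-Library.Poly_Mapping" "HOL-Algebra.Group"
begin

section \<open>Free partially commutative monoids\<close>

definition independence_alphabet :: "'a set \<Rightarrow> ('a \<times> 'a) set \<Rightarrow> bool" where
  "independence_alphabet A \<theta> \<longleftrightarrow> \<theta> \<subseteq> A \<times> A \<and> sym \<theta> \<and> irrefl \<theta>"

inductive trace_eq :: "('a \<times> 'a) set \<Rightarrow> 'a list \<Rightarrow> 'a list \<Rightarrow> bool" for \<theta> where
  refl: "trace_eq \<theta> u u"
| sym: "trace_eq \<theta> u v \<Longrightarrow> trace_eq \<theta> v u"
| trans: "trace_eq \<theta> u v \<Longrightarrow> trace_eq \<theta> v w \<Longrightarrow> trace_eq \<theta> u w"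
| swap: "(a, b) \<in> \<theta> \<Longrightarrow> trace_eq \<theta> (u @ [a, b] @ v) (u @ [b, a] @ v)"

type_synonym 'a trace = "'a list set"

definition trace_of :: "('a \<times> 'a) set \<Rightarrow> 'a list \<Rightarrow> 'a trace" where
  "trace_of \<theta> w = {v. trace_eq \<theta> w v}"

text \<open>The elements of the monoid are congruence classes of words over \<open>A\<close>. All the words
  \<open>u @ v\<close> in the product below lie in a single class, so the union is that class.\<close>

definition trace_monoid :: "'a set \<Rightarrow> ('a \<times> 'a) set \<Rightarrow> 'a trace monoid" where
  "trace_monoid A \<theta> =
     \<lparr>carrier = trace_of \<theta> ` lists A,
      mult = (\<lambda>s t. \<Union>u\<in>s. \<Union>v\<in>t. trace_of \<theta> (u @ v)),
      one = trace_of \<theta> []\<rparr>"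

definition letter :: "('a \<times> 'a) set \<Rightarrow> 'a \<Rightarrow> 'a trace" where
  "letter \<theta> a = trace_of \<theta> [a]"

definition Alph :: "'a trace \<Rightarrow> 'a set" where
  "Alph t = (\<Union>w\<in>t. set w)"

definition IA :: "'a set \<Rightarrow> ('a \<times> 'a) set \<Rightarrow> 'a trace \<Rightarrow> 'a set" where
  "IA A \<theta> t = {a \<in> A. \<exists>w \<in> carrier (trace_monoid A \<theta>). t = letter \<theta> a \<otimes>\<^bsub>trace_monoid A \<theta>\<^esub> w}"

definition submonoid_gen :: "('m, 'r) monoid_scheme \<Rightarrow> 'm set \<Rightarrow> 'm set" where
  "submonoid_gen M X = (\<lambda>H. submonoid H M) hull X"

definition theta_on :: "('a \<times> 'a) set \<Rightarrow> 'a trace set \<Rightarrow> ('a trace \<times> 'a trace) set" where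
  "theta_on \<theta> X = {(x, y). x \<in> X \<and> y \<in> X \<and> Alph x \<times> Alph y \<subseteq> \<theta>}"

definition monoid_prod_list :: "('m, 'r) monoid_scheme \<Rightarrow> 'm list \<Rightarrow> 'm" where
  "monoid_prod_list M xs = foldr (mult M) xs (one M)"

text \<open>The morphism from \<open>trace_monoid X (theta_on \<theta> X)\<close> that extends the inclusion of \<open>X\<close>:
  the class of a word over \<open>X\<close> goes to the product of the word, which is the same for all
  words of the class.\<close>

definition natural_morphism :: "('m, 'r) monoid_scheme \<Rightarrow> 'm trace \<Rightarrow> 'm" where
  "natural_morphism M c = the_elem (monoid_prod_list M ` c)"

definition pc_code :: "'a set \<Rightarrow> ('a \<times> 'a) set \<Rightarrow> 'a trace set \<Rightarrow> bool" where
  "pc_code A \<theta> X \<longleftrightarrow>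
     X \<subseteq> carrier (trace_monoid A \<theta>) \<and>
     natural_morphism (trace_monoid A \<theta>)
       \<in> iso (trace_monoid X (theta_on \<theta> X))
             ((trace_monoid A \<theta>)\<lparr>carrier := submonoid_gen (trace_monoid A \<theta>) X\<rparr>)"

text \<open>The monoid of the subalphabet \<open>B\<close> is identified with the submonoid generated by its
  letters.\<close>

definition beta :: "'a set \<Rightarrow> ('a \<times> 'a) set \<Rightarrow> 'a set \<Rightarrow> 'a set \<Rightarrow> 'a trace set" where
  "beta A \<theta> Z B =
     {t. \<exists>z\<in>Z. \<exists>w\<in>submonoid_gen (trace_monoid A \<theta>) (letter \<theta> ` B).
           t = letter \<theta> z \<otimes>\<^bsub>trace_monoid A \<theta>\<^esub> w \<and> IA A \<theta> t = {z}}"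

definition TFSA :: "'a set \<Rightarrow> ('a \<times> 'a) set \<Rightarrow> 'a set \<Rightarrow> bool" where
  "TFSA A \<theta> B \<longleftrightarrow> B \<subseteq> A \<and> pc_code A \<theta> (beta A \<theta> (A - B) B)"


section \<open>Monoid algebras and their Lie subalgebras\<close>

definition smult :: "'k::comm_ring_1 \<Rightarrow> ('m \<Rightarrow>\<^sub>0 'k) \<Rightarrow> ('m \<Rightarrow>\<^sub>0 'k)" where
  "smult c f = Poly_Mapping.map ((*) c) f"

lemma lookup_smult: "Poly_Mapping.lookup (smult c f) m = c * Poly_Mapping.lookup f m"
  by (simp add: smult_def map.rep_eq when_def)

interpretation smult: module smult
  by unfold_locales
    (auto intro!: poly_mapping_eqI simp: lookup_smult lookup_add algebra_simps)

definition monoid_algebra :: "('m, 'r) monoid_scheme \<Rightarrow> ('m \<Rightarrow>\<^sub>0 'k::comm_ring_1) set" where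
  "monoid_algebra M = {f. Poly_Mapping.keys f \<subseteq> carrier M}"

text \<open>The multiplication is not the instance \<open>(*)\<close> of finitely supported maps, which would
  need a monoid structure on the whole type \<open>'m\<close>.\<close>

definition alg_mult ::
    "('m, 'r) monoid_scheme \<Rightarrow> ('m \<Rightarrow>\<^sub>0 'k::comm_ring_1) \<Rightarrow> ('m \<Rightarrow>\<^sub>0 'k) \<Rightarrow> ('m \<Rightarrow>\<^sub>0 'k)" where
  "alg_mult M f g =
     (\<Sum>u\<in>Poly_Mapping.keys f. \<Sum>v\<in>Poly_Mapping.keys g.
        Poly_Mapping.single (u \<otimes>\<^bsub>M\<^esub> v) (Poly_Mapping.lookup f u * Poly_Mapping.lookup g v))"

definition bracket ::
    "('m, 'r) monoid_scheme \<Rightarrow> ('m \<Rightarrow>\<^sub>0 'k::comm_ring_1) \<Rightarrow> ('m \<Rightarrow>\<^sub>0 'k) \<Rightarrow> ('m \<Rightarrow>\<^sub>0 'k)" where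
  "bracket M f g = alg_mult M f g - alg_mult M g f"

definition lie_subalgebra ::
    "('m, 'r) monoid_scheme \<Rightarrow> ('m \<Rightarrow>\<^sub>0 'k::comm_ring_1) set \<Rightarrow> bool" where
  "lie_subalgebra M S \<longleftrightarrow>
     S \<subseteq> monoid_algebra M \<and> smult.subspace S \<and> (\<forall>x\<in>S. \<forall>y\<in>S. bracket M x y \<in> S)"

definition lie_gen ::
    "('m, 'r) monoid_scheme \<Rightarrow> ('m \<Rightarrow>\<^sub>0 'k::comm_ring_1) set \<Rightarrow> ('m \<Rightarrow>\<^sub>0 'k) set" where
  "lie_gen M X = lie_subalgebra M hull X"

definition lie_ideal ::
    "('m, 'r) monoid_scheme \<Rightarrow> ('m \<Rightarrow>\<^sub>0 'k::comm_ring_1) set \<Rightarrow> ('m \<Rightarrow>\<^sub>0 'k) set \<Rightarrow> bool" where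
  "lie_ideal M L J \<longleftrightarrow>
     J \<subseteq> L \<and> smult.subspace J \<and> (\<forall>x\<in>L. \<forall>y\<in>J. bracket M x y \<in> J)"

definition direct_sum ::
    "('m \<Rightarrow>\<^sub>0 'k::comm_ring_1) set \<Rightarrow> ('m \<Rightarrow>\<^sub>0 'k) set \<Rightarrow> ('m \<Rightarrow>\<^sub>0 'k) set \<Rightarrow> bool" where
  "direct_sum L U V \<longleftrightarrow>
     smult.subspace U \<and> smult.subspace V \<and> L = {u + v | u v. u \<in> U \<and> v \<in> V} \<and> U \<inter> V = {0}"

definition lie_iso ::
    "('m, 'r) monoid_scheme \<Rightarrow> ('m \<Rightarrow>\<^sub>0 'k::comm_ring_1) set \<Rightarrow>
     ('n, 's) monoid_scheme \<Rightarrow> ('n \<Rightarrow>\<^sub>0 'k) set \<Rightarrow> (('m \<Rightarrow>\<^sub>0 'k) \<Rightarrow> ('n \<Rightarrow>\<^sub>0 'k)) \<Rightarrow> bool" where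
  "lie_iso M L N L' \<phi> \<longleftrightarrow>
     bij_betw \<phi> L L' \<and>
     (\<forall>x\<in>L. \<forall>y\<in>L. \<phi> (x + y) = \<phi> x + \<phi> y) \<and>
     (\<forall>c. \<forall>x\<in>L. \<phi> (smult c x) = smult c (\<phi> x)) \<and>
     (\<forall>x\<in>L. \<forall>y\<in>L. \<phi> (bracket M x y) = bracket N (\<phi> x) (\<phi> y))"


section \<open>Free partially commutative Lie algebras\<close>

definition gen :: "('a \<times> 'a) set \<Rightarrow> 'a \<Rightarrow> 'a trace \<Rightarrow>\<^sub>0 'k::comm_ring_1" where
  "gen \<theta> a = Poly_Mapping.single (letter \<theta> a) 1"

definition free_pc_lie :: "'a set \<Rightarrow> ('a \<times> 'a) set \<Rightarrow> ('a trace \<Rightarrow>\<^sub>0 'k::comm_ring_1) set" where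
  "free_pc_lie A \<theta> = lie_gen (trace_monoid A \<theta>) (gen \<theta> ` A)"

text \<open>The alphabet is taken inside the type of the elements of the Lie algebra, without loss of
  generality: since \<open>1 \<noteq> 0\<close> in \<open>'k\<close>, distinct letters of \<open>free_pc_lie X \<theta>'\<close> are distinct
  elements, so an alphabet of any type can be replaced by its image under the isomorphism.\<close>

definition is_free_pc_lie ::
    "('m, 'r) monoid_scheme \<Rightarrow> ('m \<Rightarrow>\<^sub>0 'k::comm_ring_1) set \<Rightarrow> bool" where
  "is_free_pc_lie M L \<longleftrightarrow>
     (\<exists>(X :: ('m \<Rightarrow>\<^sub>0 'k) set) \<theta>' \<phi>. independence_alphabet X \<theta>' \<and>
        lie_iso (trace_monoid X \<theta>') (free_pc_lie X \<theta>') M L \<phi>)"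

definition is_free_pc_lie_with_code ::
    "('m, 'r) monoid_scheme \<Rightarrow> ('m \<Rightarrow>\<^sub>0 'k::comm_ring_1) set \<Rightarrow> ('m \<Rightarrow>\<^sub>0 'k) set \<Rightarrow> bool" where
  "is_free_pc_lie_with_code M L X \<longleftrightarrow>
     X \<subseteq> L \<and>
     (\<exists>\<theta>' \<phi>. independence_alphabet X \<theta>' \<and>
        lie_iso (trace_monoid X \<theta>') (free_pc_lie X \<theta>') M L \<phi> \<and>
        (\<forall>x\<in>X. \<phi> (gen \<theta>' x) = x))"

definition tau ::
    "'a set \<Rightarrow> ('a \<times> 'a) set \<Rightarrow> 'a set \<Rightarrow> 'a set \<Rightarrow> ('a trace \<Rightarrow>\<^sub>0 'k::comm_ring_1) set" where
  "tau A \<theta> Z B =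
     {foldl (bracket (trace_monoid A \<theta>)) (gen \<theta> z) (map (gen \<theta>) bs) | z bs.
        z \<in> Z \<and> bs \<in> lists B \<and> trace_of \<theta> (z # bs) \<in> beta A \<theta> Z B}"

end

theory Submission
  imports Defs "HOL-Library.Multiset"
begin

text \<open>Write an element of \<open>\<beta>\<close> as the trace \<open>x\<close> of a word \<open>z # bs\<close>, and let \<open>t\<^sub>x\<close> be the iterated
  bracket of this word, so that the \<open>t\<^sub>x\<close> are the generators of \<open>J\<close>.

  Part (i) rests on one dichotomy (\<open>code_word_snoc\<close>): for \<open>b\<close> in \<open>B\<close>, either \<open>xb\<close> is again in \<open>\<beta>\<close>,
  and then \<open>[t\<^sub>x, b] = t\<^sub>x\<^sub>b\<close>, or \<open>b\<close> commutes with all letters of \<open>x\<close>, and then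
  \<open>[t\<^sub>x, b] = 0\<close>. So \<open>J\<close> is stable under bracketing with letters of \<open>B\<close>; it contains the letters of \<open>Z\<close>,
  hence it is an ideal, and the sum of \<open>J\<close> and the subalgebra generated by \<open>B\<close> is everything. The
  sum is direct because letters of \<open>Z\<close> occur in all traces that support elements of \<open>J\<close>, and in none
  of those that support the other summand.

  Parts (ii) and (iii) go through a combinatorial condition, \<open>no_common_extension\<close>: there are no
  \<open>x\<close>, \<open>y\<close> in \<open>\<beta>\<close> with commuting alphabets and no \<open>b\<close> in \<open>B\<close> such that both \<open>xb\<close> and \<open>yb\<close> are in \<open>\<beta>\<close>.
  A TFSA satisfies it, since otherwise the trace \<open>x \<cdot> yb = y \<cdot> xb\<close> would have two factorizations.
  Conversely, assume the condition. The algebra of traces over \<open>A\<close> then acts from the right on the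
  algebra of traces over the alphabet \<open>\<beta>\<close>: a letter \<open>z\<close> of \<open>Z\<close> multiplies by the code \<open>z\<close>, and a
  letter \<open>b\<close> of \<open>B\<close> acts by the operator with
  \<open>D\<^sub>b (v y) = v (y b) + \<epsilon> D\<^sub>b (v) y\<close>, where \<open>y\<close> is a code, \<open>y b\<close> is read as \<open>0\<close> if \<open>b\<close> commutes with \<open>y\<close>,
  and \<open>\<epsilon>\<close> is \<open>1\<close> if \<open>b\<close> commutes with \<open>y\<close> and a fixed scalar \<open>q\<close> otherwise. Two values of \<open>q\<close> matter.

  For \<open>q = 1\<close> the \<open>D\<^sub>b\<close> are derivations, and \<open>t\<^sub>x\<close> acts as the multiplication by the code \<open>x\<close>
  (\<open>act_left_bracket\<close>). So the algebra map that sends each code \<open>x\<close> to \<open>t\<^sub>x\<close> can be undone by letting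
  its values act on \<open>1\<close>: it is injective, and it identifies the free partially commutative Lie
  algebra over \<open>\<beta>\<close> with \<open>J\<close>. This is part (ii).

  For \<open>q = 0\<close> the word of \<open>x\<close> itself acts as the multiplication by the code \<open>x\<close>
  (\<open>fold_op_code_word\<close>). So a product of codes, acting on \<open>1\<close>, returns its factorization, and \<open>\<beta>\<close> is a
  partially commutative code: the condition implies TFSA.

  For part (iii), a violation of the condition gives
  \<open>[[t\<^sub>x, b], t\<^sub>y] + [t\<^sub>x, [t\<^sub>y, b]] = [[t\<^sub>x, t\<^sub>y], b] = 0\<close>, a linear relation between brackets of generators.
  If \<open>J\<close> is free on the generators, each bracket in this relation must vanish, but the first one
  does not (\<open>bracket_left_bracket_nonzero\<close>).\<close>

section \<open>Traces\<close>

lemma trace_eq_append_left: "trace_eq \<theta> u v \<Longrightarrow> trace_eq \<theta> (w @ u) (w @ v)"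
proof (induction rule: trace_eq.induct)
  case (swap a b u v)
  show ?case using trace_eq.swap[OF swap, of "w @ u" v] by simp
qed (rule trace_eq.refl, erule trace_eq.sym, erule (1) trace_eq.trans)

lemma trace_eq_append_right: "trace_eq \<theta> u v \<Longrightarrow> trace_eq \<theta> (u @ w) (v @ w)"
proof (induction rule: trace_eq.induct)
  case (swap a b u v)
  show ?case using trace_eq.swap[OF swap, of u "v @ w"] by simp
qed (rule trace_eq.refl, erule trace_eq.sym, erule (1) trace_eq.trans)

lemma trace_eq_append:
  "trace_eq \<theta> u u' \<Longrightarrow> trace_eq \<theta> v v' \<Longrightarrow> trace_eq \<theta> (u @ v) (u' @ v')"
  by (meson trace_eq_append_left trace_eq_append_right trace_eq.trans)

lemma trace_eq_Cons: "trace_eq \<theta> u v \<Longrightarrow> trace_eq \<theta> (a # u) (a # v)"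
  using trace_eq_append_left[of \<theta> u v "[a]"] by simp

lemma trace_eq_mset: "trace_eq \<theta> u v \<Longrightarrow> mset u = mset v"
  by (induction rule: trace_eq.induct) auto

lemma trace_eq_set: "trace_eq \<theta> u v \<Longrightarrow> set u = set v"
  by (metis trace_eq_mset set_mset_mset)

lemma trace_eq_lists: "trace_eq \<theta> u v \<Longrightarrow> u \<in> lists A \<longleftrightarrow> v \<in> lists A"
  by (auto dest: trace_eq_set)

lemma trace_eq_swap_first: "(a, b) \<in> \<theta> \<Longrightarrow> trace_eq \<theta> (a # b # w) (b # a # w)"
  using trace_eq.swap[of a b \<theta> "[]" w] by simp

lemma trace_of_eq_iff: "trace_of \<theta> u = trace_of \<theta> v \<longleftrightarrow> trace_eq \<theta> u v"
proof
  assume "trace_of \<theta> u = trace_of \<theta> v"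
  then have "v \<in> trace_of \<theta> u" by (simp add: trace_of_def trace_eq.refl)
  then show "trace_eq \<theta> u v" by (simp add: trace_of_def)
next
  assume "trace_eq \<theta> u v"
  then have "trace_eq \<theta> u w \<longleftrightarrow> trace_eq \<theta> v w" for w
    by (meson trace_eq.sym trace_eq.trans)
  then show "trace_of \<theta> u = trace_of \<theta> v" by (simp add: trace_of_def)
qed

lemma mem_trace_of: "v \<in> trace_of \<theta> u \<longleftrightarrow> trace_eq \<theta> u v"
  by (simp add: trace_of_def)

lemma self_mem_trace_of: "u \<in> trace_of \<theta> u"
  by (simp add: mem_trace_of trace_eq.refl)

text \<open>Functions on traces are obtained from functions on words by evaluation at an arbitrary
  representative; it is enough to check that swapping two adjacent letters changes nothing.\<close>

lemma invariant_if_swap_invariant: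
  assumes "trace_eq \<theta> u v"
    and "\<And>a b u v. (a, b) \<in> \<theta> \<Longrightarrow> F (u @ [a, b] @ v) = F (u @ [b, a] @ v)"
  shows "F u = F v"
  using assms(1) by (induction rule: trace_eq.induct) (use assms(2) in auto)

definition on_trace :: "('a list \<Rightarrow> 'b) \<Rightarrow> 'a trace \<Rightarrow> 'b" where
  "on_trace F c = F (SOME w. w \<in> c)"

lemma on_trace_trace_of:
  assumes "\<And>a b u v. (a, b) \<in> \<theta> \<Longrightarrow> F (u @ [a, b] @ v) = F (u @ [b, a] @ v)"
  shows "on_trace F (trace_of \<theta> w) = F w"
proof -
  have "trace_eq \<theta> w (SOME v. v \<in> trace_of \<theta> w)"
    using someI[of "\<lambda>v. v \<in> trace_of \<theta> w", OF self_mem_trace_of] by (simp add: mem_trace_of)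
  then have "F w = F (SOME v. v \<in> trace_of \<theta> w)"
    by (rule invariant_if_swap_invariant) (rule assms)
  then show ?thesis by (simp add: on_trace_def)
qed

lemma trace_mult: "trace_of \<theta> u \<otimes>\<^bsub>trace_monoid A \<theta>\<^esub> trace_of \<theta> v = trace_of \<theta> (u @ v)"
proof -
  have "trace_of \<theta> (u' @ v') = trace_of \<theta> (u @ v)"
    if "u' \<in> trace_of \<theta> u" "v' \<in> trace_of \<theta> v" for u' v'
    using that[unfolded mem_trace_of, THEN trace_eq.sym] unfolding trace_of_eq_iff
    by (rule trace_eq_append)
  moreover have "trace_of \<theta> u \<noteq> {}" "trace_of \<theta> v \<noteq> {}"
    using self_mem_trace_of by auto
  ultimately show ?thesis by (simp add: trace_monoid_def)
qed

lemma carrier_trace_monoid: "carrier (trace_monoid A \<theta>) = trace_of \<theta> ` lists A"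
  by (simp add: trace_monoid_def)

lemma one_trace_monoid: "\<one>\<^bsub>trace_monoid A \<theta>\<^esub> = trace_of \<theta> []"
  by (simp add: trace_monoid_def)

lemma UN_trace_append:
  "(\<Union>p\<in>trace_of \<theta> u. trace_of \<theta> (p @ w)) = trace_of \<theta> (u @ w)"
  "(\<Union>p\<in>trace_of \<theta> u. trace_of \<theta> (w @ p)) = trace_of \<theta> (w @ u)"
proof -
  have "trace_of \<theta> (p @ w) = trace_of \<theta> (u @ w)" "trace_of \<theta> (w @ p) = trace_of \<theta> (w @ u)"
    if "p \<in> trace_of \<theta> u" for p
  proof -
    have "trace_eq \<theta> p u" using that[unfolded mem_trace_of] by (rule trace_eq.sym)
    then show "trace_of \<theta> (p @ w) = trace_of \<theta> (u @ w)" "trace_of \<theta> (w @ p) = trace_of \<theta> (w @ u)"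
      by (simp_all only: trace_of_eq_iff trace_eq_append_right trace_eq_append_left)
  qed
  moreover have "trace_of \<theta> u \<noteq> {}" using self_mem_trace_of by auto
  ultimately show "(\<Union>p\<in>trace_of \<theta> u. trace_of \<theta> (p @ w)) = trace_of \<theta> (u @ w)"
    "(\<Union>p\<in>trace_of \<theta> u. trace_of \<theta> (w @ p)) = trace_of \<theta> (w @ u)"
    by (simp_all cong: SUP_cong)
qed

text \<open>Each factor enters only through the classes of the concatenations, so associativity holds for
  arbitrary sets of words. The algebra product is therefore associative on all finitely supported
  maps.\<close>

lemma trace_mult_assoc:
  "(s \<otimes>\<^bsub>trace_monoid A \<theta>\<^esub> t) \<otimes>\<^bsub>trace_monoid A \<theta>\<^esub> r = s \<otimes>\<^bsub>trace_monoid A \<theta>\<^esub> (t \<otimes>\<^bsub>trace_monoid A \<theta>\<^esub> r)"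
proof -
  have 1: "(\<Union>p\<in>trace_of \<theta> u. \<Union>w\<in>r. trace_of \<theta> (p @ w)) = (\<Union>w\<in>r. trace_of \<theta> (u @ w))" for u
    unfolding SUP_commute[of _ r] UN_trace_append ..
  have "(s \<otimes>\<^bsub>trace_monoid A \<theta>\<^esub> t) \<otimes>\<^bsub>trace_monoid A \<theta>\<^esub> r
      = (\<Union>u\<in>s. \<Union>v\<in>t. \<Union>w\<in>r. trace_of \<theta> ((u @ v) @ w))"
    by (simp only: trace_monoid_def monoid.simps UN_UN_flatten 1)
  moreover have "s \<otimes>\<^bsub>trace_monoid A \<theta>\<^esub> (t \<otimes>\<^bsub>trace_monoid A \<theta>\<^esub> r)
      = (\<Union>u\<in>s. \<Union>v\<in>t. \<Union>w\<in>r. trace_of \<theta> (u @ v @ w))"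
    by (simp only: trace_monoid_def monoid.simps UN_UN_flatten UN_trace_append)
  ultimately show ?thesis by simp
qed

lemma Alph_trace_of: "Alph (trace_of \<theta> w) = set w"
proof -
  have "set v = set w" if "v \<in> trace_of \<theta> w" for v
    using trace_eq_set that[unfolded mem_trace_of] by metis
  moreover have "trace_of \<theta> w \<noteq> {}" using self_mem_trace_of by auto
  ultimately show ?thesis by (simp add: Alph_def cong: SUP_cong)
qed

text \<open>Whether a letter can be moved to the front of a word, past letters that commute with it. This
  computes the set \<open>IA\<close> on words.\<close>

primrec initial :: "('a \<times> 'a) set \<Rightarrow> 'a \<Rightarrow> 'a list \<Rightarrow> bool" where
  "initial \<theta> a [] \<longleftrightarrow> False"
| "initial \<theta> a (c # w) \<longleftrightarrow> c = a \<or> (c, a) \<in> \<theta> \<and> initial \<theta> a w"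

lemma initial_append:
  "initial \<theta> a (u @ v) \<longleftrightarrow> initial \<theta> a u \<or> (\<forall>c\<in>set u. (c, a) \<in> \<theta>) \<and> initial \<theta> a v"
  by (induction u) auto

lemma initial_trace_eq:
  assumes "sym \<theta>" "trace_eq \<theta> u v"
  shows "initial \<theta> a u \<longleftrightarrow> initial \<theta> a v"
  using assms(2)
proof (rule invariant_if_swap_invariant)
  fix c d u v assume "(c, d) \<in> \<theta>"
  moreover have "(d, c) \<in> \<theta>" using assms(1) calculation by (auto dest: symD)
  ultimately show "initial \<theta> a (u @ [c, d] @ v) = initial \<theta> a (u @ [d, c] @ v)"
    by (auto simp: initial_append)
qed

lemma initial_imp_front: "initial \<theta> a w \<Longrightarrow> \<exists>w'. trace_eq \<theta> w (a # w')"
proof (induction w)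
  case (Cons c w)
  show ?case
  proof (cases "c = a")
    case False
    with Cons obtain w' where "(c, a) \<in> \<theta>" "trace_eq \<theta> w (a # w')" by auto
    then have "trace_eq \<theta> (c # w) (a # c # w')"
      by (meson trace_eq_Cons trace_eq_swap_first trace_eq.trans)
    then show ?thesis by blast
  qed (auto intro: trace_eq.refl)
qed simp

lemma IA_trace_of:
  assumes "sym \<theta>" "w \<in> lists A"
  shows "IA A \<theta> (trace_of \<theta> w) = {a. initial \<theta> a w}"
proof -
  have "initial \<theta> a w" if "trace_eq \<theta> w (a # v)" for a v
    using initial_trace_eq[OF assms(1) that] by simp
  moreover have "a \<in> A \<and> (\<exists>v\<in>lists A. trace_eq \<theta> w (a # v))" if "initial \<theta> a w" for a
  proof -
    from initial_imp_front[OF that] obtain v where v: "trace_eq \<theta> w (a # v)" ..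
    have "a # v \<in> lists A" using trace_eq_lists[OF v] assms(2) by blast
    with v show ?thesis by auto
  qed
  ultimately show ?thesis
    by (auto simp: IA_def carrier_trace_monoid letter_def trace_mult trace_of_eq_iff)
qed

text \<open>Removing the first occurrence of a letter is compatible with the congruence, so that equal
  first letters can be cancelled.\<close>

lemma trace_eq_remove1: "trace_eq \<theta> u v \<Longrightarrow> trace_eq \<theta> (remove1 a u) (remove1 a v)"
proof (induction rule: trace_eq.induct)
  case (swap c d u v)
  then have "trace_eq \<theta> (u @ [c, d] @ remove1 a v) (u @ [d, c] @ remove1 a v)"
    "trace_eq \<theta> (remove1 a u @ [c, d] @ v) (remove1 a u @ [d, c] @ v)"
    by (blast intro: trace_eq.swap)+
  then show ?case by (auto simp: remove1_append intro: trace_eq.refl)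
qed (rule trace_eq.refl, erule trace_eq.sym, erule (1) trace_eq.trans)

lemma trace_eq_cancel_left: "trace_eq \<theta> (u @ v) (u @ w) \<Longrightarrow> trace_eq \<theta> v w"
proof (induction u)
  case (Cons a u)
  then show ?case using trace_eq_remove1[of \<theta> "a # u @ v" "a # u @ w" a] by simp
qed simp

lemma trace_eq_commute:
  "set u \<times> set v \<subseteq> \<theta> \<Longrightarrow> trace_eq \<theta> (u @ v) (v @ u)"
proof (induction u)
  case (Cons a u)
  have "trace_eq \<theta> (a # v) (v @ [a])" using Cons.prems
  proof (induction v)
    case (Cons b v)
    then have "trace_eq \<theta> (b # a # v) (b # v @ [a])"
      by (intro trace_eq_Cons) auto
    moreover have "trace_eq \<theta> (a # b # v) (b # a # v)"
      using Cons.prems by (intro trace_eq_swap_first) auto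
    ultimately show ?case by (auto intro: trace_eq.trans)
  qed (simp add: trace_eq.refl)
  from trace_eq_append_right[OF this, of u] have "trace_eq \<theta> (a # v @ u) (v @ a # u)" by simp
  moreover have "trace_eq \<theta> (a # u @ v) (a # v @ u)"
    using Cons by (intro trace_eq_Cons) auto
  ultimately show ?case by (auto intro: trace_eq.trans)
qed (simp add: trace_eq.refl)

section \<open>Linear maps and the multiplication of monoid algebras\<close>

abbreviation klinear :: "(('m \<Rightarrow>\<^sub>0 'k::comm_ring_1) \<Rightarrow> ('n \<Rightarrow>\<^sub>0 'k)) \<Rightarrow> bool" where
  "klinear \<equiv> module_hom smult smult"

lemma klinear_iff:
  "klinear h \<longleftrightarrow> (\<forall>x y. h (x + y) = h x + h y) \<and> (\<forall>c x. h (smult c x) = smult c (h x))"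
  by (simp add: module_hom_iff smult.module_axioms)

lemma klinear_comp: "klinear h \<Longrightarrow> klinear g \<Longrightarrow> klinear (\<lambda>x. h (g x))"
  by (simp add: klinear_iff)

lemma keys_smult: "Poly_Mapping.keys (smult c f) \<subseteq> Poly_Mapping.keys f"
  by (auto simp: in_keys_iff lookup_smult)

definition linear_extension ::
    "('m \<Rightarrow> ('n \<Rightarrow>\<^sub>0 'k)) \<Rightarrow> ('m \<Rightarrow>\<^sub>0 'k::comm_ring_1) \<Rightarrow> ('n \<Rightarrow>\<^sub>0 'k)" where
  "linear_extension F f =
     (\<Sum>u\<in>Poly_Mapping.keys f. smult (Poly_Mapping.lookup f u) (F u))"

lemma linear_extension_superset:
  assumes "finite S" "Poly_Mapping.keys f \<subseteq> S"
  shows "linear_extension F f = (\<Sum>u\<in>S. smult (Poly_Mapping.lookup f u) (F u))"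
  unfolding linear_extension_def
  using assms by (intro sum.mono_neutral_left) (auto simp: in_keys_iff)

lemma klinear_linear_extension: "klinear (linear_extension F)"
proof -
  have "linear_extension F (x + y) = linear_extension F x + linear_extension F y" for x y
  proof -
    let ?S = "Poly_Mapping.keys x \<union> Poly_Mapping.keys y"
    have "Poly_Mapping.keys (x + y) \<subseteq> ?S" by (rule keys_add)
    then show ?thesis
      by (simp add: linear_extension_superset[of ?S] lookup_add smult.scale_left_distrib
          sum.distrib)
  qed
  moreover have "linear_extension F (smult c x) = smult c (linear_extension F x)" for c x
    by (simp add: linear_extension_superset[OF _ keys_smult] linear_extension_def[of F x]
        lookup_smult smult.scale_sum_right)
  ultimately show ?thesis by (simp add: klinear_iff)
qed

lemma linear_extension_single: "linear_extension F (Poly_Mapping.single u c) = smult c (F u)"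
  by (simp add: linear_extension_superset[of "{u}"])

lemma linear_extension_self: "linear_extension (\<lambda>u. Poly_Mapping.single u 1) f = f"
proof (rule poly_mapping_eqI)
  fix m
  show "Poly_Mapping.lookup (linear_extension (\<lambda>u. Poly_Mapping.single u 1) f) m
      = Poly_Mapping.lookup f m"
    by (simp add: linear_extension_def lookup_sum lookup_smult lookup_single when_def
        in_keys_iff if_distrib[of "(*) _"] sum.delta cong: if_cong)
qed

lemma klinear_cong:
  assumes g: "klinear g" and h: "klinear h"
    and eq: "\<And>m. m \<in> Poly_Mapping.keys f
      \<Longrightarrow> g (Poly_Mapping.single m 1) = h (Poly_Mapping.single m 1)"
  shows "g f = h f"
proof -
  have *: "k f = (\<Sum>u\<in>Poly_Mapping.keys f.
      smult (Poly_Mapping.lookup f u) (k (Poly_Mapping.single u 1)))" if "klinear k" for k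
  proof -
    interpret k: module_hom smult smult k by fact
    have "k f = k (linear_extension (\<lambda>u. Poly_Mapping.single u 1) f)"
      by (simp add: linear_extension_self)
    then show ?thesis by (simp add: linear_extension_def k.sum k.scale)
  qed
  show ?thesis
    unfolding *[OF g] *[OF h] by (intro sum.cong) (simp_all add: eq)
qed

lemma keys_linear_extension:
  "Poly_Mapping.keys (linear_extension F f)
     \<subseteq> (\<Union>u\<in>Poly_Mapping.keys f. Poly_Mapping.keys (F u))"
  unfolding linear_extension_def
  by (rule order_trans[OF keys_sum]) (intro UN_mono subset_refl keys_smult)

lemma klinear_monoid_algebra:
  assumes "klinear h" and "f \<in> monoid_algebra M"
    and "\<And>m. m \<in> carrier M \<Longrightarrow> h (Poly_Mapping.single m 1) \<in> S" and "smult.subspace S"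
  shows "h f \<in> S"
proof -
  have "h f = linear_extension (\<lambda>u. h (Poly_Mapping.single u 1)) f"
  proof (rule klinear_cong[OF assms(1) klinear_linear_extension])
    fix m show "h (Poly_Mapping.single m 1)
        = linear_extension (\<lambda>u. h (Poly_Mapping.single u 1)) (Poly_Mapping.single m 1)"
      by (simp add: linear_extension_single)
  qed
  also have "\<dots> \<in> S"
    unfolding linear_extension_def
  proof (rule smult.subspace_sum[OF assms(4)])
    fix u assume "u \<in> Poly_Mapping.keys f"
    with assms(2) have "u \<in> carrier M" by (auto simp: monoid_algebra_def)
    with assms(3,4) show "smult (Poly_Mapping.lookup f u) (h (Poly_Mapping.single u 1)) \<in> S"
      by (blast intro: smult.subspace_scale)
  qed
  finally show ?thesis .
qed

lemma klinear_cong_algebra: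
  assumes "klinear g" "klinear h" "f \<in> monoid_algebra M"
    and "\<And>m. m \<in> carrier M \<Longrightarrow> g (Poly_Mapping.single m 1) = h (Poly_Mapping.single m 1)"
  shows "g f = h f"
proof (rule klinear_cong[OF assms(1,2)])
  fix m assume "m \<in> Poly_Mapping.keys f"
  then have "m \<in> carrier M" using assms(3) by (auto simp: monoid_algebra_def)
  then show "g (Poly_Mapping.single m 1) = h (Poly_Mapping.single m 1)" by (rule assms(4))
qed

lemma klinear_linear_extension_family:
  assumes "\<And>u. u \<in> Poly_Mapping.keys f \<Longrightarrow> klinear (\<lambda>x. F x u)"
  shows "klinear (\<lambda>x. linear_extension (F x) f)"
  using assms by (simp add: klinear_iff linear_extension_def sum.distrib smult.scale_sum_right
      smult.scale_right_distrib mult.commute)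

lemma smult_single: "smult c (Poly_Mapping.single m d) = Poly_Mapping.single m (c * d)"
  by (intro poly_mapping_eqI) (auto simp: lookup_smult lookup_single when_def)

text \<open>Bilinearity of the product becomes an instance of the linearity of \<open>linear_extension\<close>.\<close>

lemma alg_mult_eq_linear_extension:
  "alg_mult M f g =
     linear_extension (\<lambda>u. linear_extension (\<lambda>v. Poly_Mapping.single (u \<otimes>\<^bsub>M\<^esub> v) 1) g) f"
  by (simp add: alg_mult_def linear_extension_def smult.scale_sum_right smult_single)

lemma klinear_alg_mult_left: "klinear (\<lambda>f. alg_mult M f g)"
  unfolding alg_mult_eq_linear_extension by (rule klinear_linear_extension)

lemma klinear_alg_mult_right: "klinear (alg_mult M f)"
  unfolding alg_mult_eq_linear_extension
  by (intro klinear_linear_extension_family klinear_linear_extension)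

lemmas alg_mult_distribs =
  module_hom.add[OF klinear_alg_mult_left] module_hom.add[OF klinear_alg_mult_right]
  module_hom.diff[OF klinear_alg_mult_left] module_hom.diff[OF klinear_alg_mult_right]
  module_hom.neg[OF klinear_alg_mult_left] module_hom.neg[OF klinear_alg_mult_right]
  module_hom.scale[OF klinear_alg_mult_left] module_hom.scale[OF klinear_alg_mult_right]
  module_hom.zero[OF klinear_alg_mult_left] module_hom.zero[OF klinear_alg_mult_right]

lemma alg_mult_single:
  "alg_mult M (Poly_Mapping.single u 1) (Poly_Mapping.single v (1::'k::comm_ring_1))
     = Poly_Mapping.single (u \<otimes>\<^bsub>M\<^esub> v) 1"
  by (simp add: alg_mult_eq_linear_extension linear_extension_single)

lemma keys_alg_mult:
  "Poly_Mapping.keys (alg_mult M f g)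
     \<subseteq> {u \<otimes>\<^bsub>M\<^esub> v | u v. u \<in> Poly_Mapping.keys f \<and> v \<in> Poly_Mapping.keys g}"
proof -
  have "Poly_Mapping.keys (alg_mult M f g)
    \<subseteq> (\<Union>u\<in>Poly_Mapping.keys f. \<Union>v\<in>Poly_Mapping.keys g.
        Poly_Mapping.keys (Poly_Mapping.single (u \<otimes>\<^bsub>M\<^esub> v) (1::'b)))"
    unfolding alg_mult_eq_linear_extension
    by (rule order_trans[OF keys_linear_extension]) (intro UN_mono subset_refl keys_linear_extension)
  also have "\<dots> = {u \<otimes>\<^bsub>M\<^esub> v | u v. u \<in> Poly_Mapping.keys f \<and> v \<in> Poly_Mapping.keys g}"
    by auto
  finally show ?thesis .
qed

lemma alg_mult_trace_assoc:
  "alg_mult (trace_monoid A \<theta>) (alg_mult (trace_monoid A \<theta>) f g) h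
     = alg_mult (trace_monoid A \<theta>) f (alg_mult (trace_monoid A \<theta>) g h)"
proof -
  let ?m = "alg_mult (trace_monoid A \<theta>)"
  let ?s = "\<lambda>u. Poly_Mapping.single u (1::'b)"
  have 1: "?m (?m (?s u) (?s v)) h = ?m (?s u) (?m (?s v) h)" for u v
    by (rule klinear_cong[of "\<lambda>h. ?m (?m (?s u) (?s v)) h"])
      (auto intro!: klinear_comp[OF klinear_alg_mult_right] klinear_alg_mult_right
        simp: alg_mult_single trace_mult_assoc)
  have 2: "?m (?m (?s u) g) h = ?m (?s u) (?m g h)" for u
    by (rule klinear_cong[of "\<lambda>g. ?m (?m (?s u) g) h"])
      (auto intro: klinear_comp[OF klinear_alg_mult_right] klinear_comp[OF klinear_alg_mult_left]
         klinear_alg_mult_left klinear_alg_mult_right simp: 1)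
  show ?thesis
    by (rule klinear_cong[of "\<lambda>f. ?m (?m f g) h"])
      (auto intro: klinear_comp[OF klinear_alg_mult_left] klinear_alg_mult_left simp: 2)
qed

section \<open>Lie subalgebras of the algebra of traces\<close>

definition word_elt :: "('a \<times> 'a) set \<Rightarrow> 'a list \<Rightarrow> ('a trace \<Rightarrow>\<^sub>0 'k::comm_ring_1)" where
  "word_elt \<theta> w = Poly_Mapping.single (trace_of \<theta> w) 1"

lemma gen_word_elt: "gen \<theta> a = word_elt \<theta> [a]"
  by (simp add: gen_def letter_def word_elt_def)

lemma word_elt_mult: "alg_mult (trace_monoid A \<theta>) (word_elt \<theta> u) (word_elt \<theta> v) = word_elt \<theta> (u @ v)"
  by (simp add: word_elt_def alg_mult_single trace_mult)

lemma word_elt_eq_iff: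
  "(word_elt \<theta> u :: _ \<Rightarrow>\<^sub>0 'k::comm_ring_1) = word_elt \<theta> v \<longleftrightarrow> trace_eq \<theta> u v"
proof
  assume "(word_elt \<theta> u :: _ \<Rightarrow>\<^sub>0 'k) = word_elt \<theta> v"
  then have "Poly_Mapping.keys (word_elt \<theta> u :: _ \<Rightarrow>\<^sub>0 'k) = Poly_Mapping.keys (word_elt \<theta> v :: _ \<Rightarrow>\<^sub>0 'k)"
    by simp
  then show "trace_eq \<theta> u v" by (simp add: word_elt_def trace_of_eq_iff)
next
  assume "trace_eq \<theta> u v"
  then show "word_elt \<theta> u = word_elt \<theta> v" by (simp add: word_elt_def trace_of_eq_iff[symmetric])
qed

lemma subspace_keys: "smult.subspace {f. Poly_Mapping.keys f \<subseteq> S}"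
  by (auto simp: smult.subspace_def dest!: subsetD[OF keys_add] subsetD[OF keys_smult])

lemma subspace_monoid_algebra: "smult.subspace (monoid_algebra M)"
  unfolding monoid_algebra_def by (rule subspace_keys)

lemma monoid_algebra_word_elt: "w \<in> lists A \<Longrightarrow> word_elt \<theta> w \<in> monoid_algebra (trace_monoid A \<theta>)"
  by (simp add: monoid_algebra_def word_elt_def carrier_trace_monoid)

lemma monoid_algebra_mono:
  "f \<in> monoid_algebra (trace_monoid S \<theta>) \<Longrightarrow> S \<subseteq> A \<Longrightarrow> f \<in> monoid_algebra (trace_monoid A \<theta>)"
  unfolding monoid_algebra_def carrier_trace_monoid mem_Collect_eq
  by (meson image_mono lists_mono order_trans)

lemma monoid_algebra_mult:
  assumes "f \<in> monoid_algebra (trace_monoid A \<theta>)" "g \<in> monoid_algebra (trace_monoid A \<theta>)"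
  shows "alg_mult (trace_monoid A' \<theta>) f g \<in> monoid_algebra (trace_monoid A \<theta>)"
proof -
  have "u \<otimes>\<^bsub>trace_monoid A' \<theta>\<^esub> v \<in> trace_of \<theta> ` lists A"
    if "u \<in> trace_of \<theta> ` lists A" "v \<in> trace_of \<theta> ` lists A" for u v
  proof -
    from that obtain w w' where "w \<in> lists A" "w' \<in> lists A" "u = trace_of \<theta> w" "v = trace_of \<theta> w'"
      by blast
    then show ?thesis by (auto simp: trace_mult)
  qed
  then have "{u \<otimes>\<^bsub>trace_monoid A' \<theta>\<^esub> v | u v. u \<in> Poly_Mapping.keys f \<and> v \<in> Poly_Mapping.keys g}
      \<subseteq> trace_of \<theta> ` lists A"
    using assms unfolding monoid_algebra_def carrier_trace_monoid by (auto simp only: subset_eq)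
  with keys_alg_mult show ?thesis
    unfolding monoid_algebra_def carrier_trace_monoid mem_Collect_eq by (rule order_trans)
qed

lemma klinear_cong_words:
  assumes "klinear g" "klinear h" "f \<in> monoid_algebra (trace_monoid A \<theta>)"
    and "\<And>w. w \<in> lists A \<Longrightarrow> g (word_elt \<theta> w) = h (word_elt \<theta> w)"
  shows "g f = h f"
proof (rule klinear_cong_algebra[OF assms(1-3)])
  fix m assume "m \<in> carrier (trace_monoid A \<theta>)"
  then obtain w where w: "w \<in> lists A" "m = trace_of \<theta> w" unfolding carrier_trace_monoid ..
  show "g (Poly_Mapping.single m 1) = h (Poly_Mapping.single m 1)"
    using assms(4)[OF w(1)] unfolding w(2) word_elt_def .
qed

lemma klinear_image_words:
  assumes "klinear h" and "f \<in> monoid_algebra (trace_monoid A \<theta>)"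
    and "\<And>w. w \<in> lists A \<Longrightarrow> h (word_elt \<theta> w) \<in> S" and "smult.subspace S"
  shows "h f \<in> S"
proof (rule klinear_monoid_algebra[OF assms(1,2) _ assms(4)])
  fix m assume "m \<in> carrier (trace_monoid A \<theta>)"
  then obtain w where w: "w \<in> lists A" "m = trace_of \<theta> w" unfolding carrier_trace_monoid ..
  show "h (Poly_Mapping.single m 1) \<in> S"
    using assms(3)[OF w(1)] unfolding w(2) word_elt_def .
qed

lemma alg_mult_one_right:
  assumes "f \<in> monoid_algebra (trace_monoid A \<theta>)"
  shows "alg_mult (trace_monoid A' \<theta>) f (word_elt \<theta> []) = f"
proof (rule klinear_cong_words[OF _ smult.module_hom_ident assms])
  show "klinear (\<lambda>f. alg_mult (trace_monoid A' \<theta>) f (word_elt \<theta> []))"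
    by (rule klinear_alg_mult_left)
qed (simp add: word_elt_mult)

lemma alg_mult_one_left:
  assumes "f \<in> monoid_algebra (trace_monoid A \<theta>)"
  shows "alg_mult (trace_monoid A' \<theta>) (word_elt \<theta> []) f = f"
  by (rule klinear_cong_words[where g = "alg_mult (trace_monoid A' \<theta>) (word_elt \<theta> [])",
        OF klinear_alg_mult_right smult.module_hom_ident assms])
    (simp add: word_elt_mult)

lemma klinear_bracket_left: "klinear (\<lambda>f. bracket M f g)"
  by (simp add: klinear_iff bracket_def alg_mult_distribs smult.scale_right_diff_distrib)

lemma klinear_bracket_right: "klinear (bracket M f)"
  by (simp add: klinear_iff bracket_def alg_mult_distribs smult.scale_right_diff_distrib)

lemmas bracket_distribs =
  module_hom.add[OF klinear_bracket_left] module_hom.add[OF klinear_bracket_right]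
  module_hom.scale[OF klinear_bracket_left] module_hom.scale[OF klinear_bracket_right]
  module_hom.zero[OF klinear_bracket_left] module_hom.zero[OF klinear_bracket_right]

lemma bracket_swap: "bracket M f g = - bracket M g f"
  by (simp add: bracket_def)

text \<open>The Jacobi identity, in the form in which it is applied: bracketing with a fixed element is a
  derivation.\<close>

lemma bracket_derivation:
  "bracket (trace_monoid A \<theta>) (bracket (trace_monoid A \<theta>) x y) b =
   bracket (trace_monoid A \<theta>) (bracket (trace_monoid A \<theta>) x b) y +
   bracket (trace_monoid A \<theta>) x (bracket (trace_monoid A \<theta>) y b)"
  by (simp add: bracket_def alg_mult_distribs alg_mult_trace_assoc algebra_simps)

lemma bracket_trace_monoid: "bracket (trace_monoid A \<theta>) = bracket (trace_monoid A' \<theta>)"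
  by (intro ext) (simp add: bracket_def alg_mult_def trace_monoid_def)

lemma monoid_algebra_bracket:
  "f \<in> monoid_algebra (trace_monoid A \<theta>) \<Longrightarrow> g \<in> monoid_algebra (trace_monoid A \<theta>)
   \<Longrightarrow> bracket (trace_monoid A' \<theta>) f g \<in> monoid_algebra (trace_monoid A \<theta>)"
  unfolding bracket_def
  by (intro smult.subspace_diff subspace_monoid_algebra monoid_algebra_mult)

lemma bracket_eq_0_if_alphabets_commute:
  assumes f: "f \<in> monoid_algebra (trace_monoid S \<theta>)"
    and g: "g \<in> monoid_algebra (trace_monoid S' \<theta>)" and "S \<times> S' \<subseteq> \<theta>"
  shows "bracket (trace_monoid A \<theta>) f g = 0"
proof -
  have 0: "klinear (\<lambda>_. 0)" by (simp add: klinear_iff)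
  have "bracket (trace_monoid A \<theta>) (word_elt \<theta> u) g = 0" if u: "u \<in> lists S" for u
  proof (rule klinear_cong_words[OF klinear_bracket_right 0 g])
    fix v assume "v \<in> lists S'"
    with u assms(3) have "trace_eq \<theta> (u @ v) (v @ u)" by (intro trace_eq_commute) auto
    then show "bracket (trace_monoid A \<theta>) (word_elt \<theta> u) (word_elt \<theta> v) = 0"
      by (simp add: bracket_def word_elt_mult word_elt_eq_iff)
  qed
  then show ?thesis by (rule klinear_cong_words[OF klinear_bracket_left 0 f])
qed

lemma lie_subalgebraI:
  assumes "\<And>x. x \<in> S \<Longrightarrow> x \<in> monoid_algebra M" "0 \<in> S"
    and "\<And>x y. x \<in> S \<Longrightarrow> y \<in> S \<Longrightarrow> x + y \<in> S" "\<And>c x. x \<in> S \<Longrightarrow> smult c x \<in> S"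
    and "\<And>x y. x \<in> S \<Longrightarrow> y \<in> S \<Longrightarrow> bracket M x y \<in> S"
  shows "lie_subalgebra M S"
  using assms by (simp add: lie_subalgebra_def smult.subspace_def subset_eq)

lemma lie_subalgebraD:
  assumes "lie_subalgebra M S"
  shows "\<And>x. x \<in> S \<Longrightarrow> x \<in> monoid_algebra M" "0 \<in> S"
    and "\<And>x y. x \<in> S \<Longrightarrow> y \<in> S \<Longrightarrow> x + y \<in> S" "\<And>c x. x \<in> S \<Longrightarrow> smult c x \<in> S"
    and "\<And>x. x \<in> S \<Longrightarrow> - x \<in> S"
    and "\<And>x y. x \<in> S \<Longrightarrow> y \<in> S \<Longrightarrow> bracket M x y \<in> S"
  using assms smult.subspace_neg unfolding lie_subalgebra_def smult.subspace_def by blast+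

lemma lie_subalgebra_monoid_algebra:
  "lie_subalgebra (trace_monoid A \<theta>) (monoid_algebra (trace_monoid A \<theta>))"
  unfolding lie_subalgebra_def
  using subspace_monoid_algebra by (auto intro: monoid_algebra_bracket)

lemma lie_gen_minimal: "X \<subseteq> S \<Longrightarrow> lie_subalgebra M S \<Longrightarrow> lie_gen M X \<subseteq> S"
  unfolding lie_gen_def by (rule hull_minimal)

lemma lie_gen_superset: "X \<subseteq> lie_gen M X"
  unfolding lie_gen_def by (rule hull_subset)

lemma lie_subalgebra_lie_gen:
  assumes "X \<subseteq> monoid_algebra (trace_monoid A \<theta>)"
  shows "lie_subalgebra (trace_monoid A \<theta>) (lie_gen (trace_monoid A \<theta>) X)"
proof (rule lie_subalgebraI)
  fix x assume "x \<in> lie_gen (trace_monoid A \<theta>) X"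
  then show "x \<in> monoid_algebra (trace_monoid A \<theta>)"
    using lie_gen_minimal[OF assms lie_subalgebra_monoid_algebra] by blast
qed (auto simp: lie_gen_def hull_def dest: lie_subalgebraD)

lemma lie_gen_induct [consumes 2, case_names generator zero add scale bracket]:
  assumes "x \<in> lie_gen (trace_monoid A \<theta>) X" "X \<subseteq> monoid_algebra (trace_monoid A \<theta>)"
    and "\<And>x. x \<in> X \<Longrightarrow> P x" "P 0"
    and "\<And>x y. x \<in> lie_gen (trace_monoid A \<theta>) X \<Longrightarrow> y \<in> lie_gen (trace_monoid A \<theta>) X
      \<Longrightarrow> P x \<Longrightarrow> P y \<Longrightarrow> P (x + y)"
    and "\<And>c x. x \<in> lie_gen (trace_monoid A \<theta>) X \<Longrightarrow> P x \<Longrightarrow> P (smult c x)"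
    and "\<And>x y. x \<in> lie_gen (trace_monoid A \<theta>) X \<Longrightarrow> y \<in> lie_gen (trace_monoid A \<theta>) X
      \<Longrightarrow> P x \<Longrightarrow> P y \<Longrightarrow> P (bracket (trace_monoid A \<theta>) x y)"
  shows "P x"
proof -
  let ?L = "lie_gen (trace_monoid A \<theta>) X"
  note L = lie_subalgebraD[OF lie_subalgebra_lie_gen[OF assms(2)]]
  have "lie_subalgebra (trace_monoid A \<theta>) {x \<in> ?L. P x}"
    by (rule lie_subalgebraI) (simp_all add: L assms(4-7))
  moreover have "X \<subseteq> {x \<in> ?L. P x}"
    using lie_gen_superset assms(3) by blast
  ultimately have "?L \<subseteq> {x \<in> ?L. P x}" by (intro lie_gen_minimal)
  with assms(1) show ?thesis by blast
qed

lemma gens_in_algebra: "X \<subseteq> A \<Longrightarrow> gen \<theta> ` X \<subseteq> monoid_algebra (trace_monoid A \<theta>)"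
  by (auto simp: gen_word_elt intro!: monoid_algebra_word_elt)

section \<open>Codes and iterated brackets\<close>

text \<open>The bracket of \<open>trace_monoid A \<theta>\<close> is the same for all \<open>A\<close>; taking \<open>UNIV\<close> gives one constant for
  all alphabets.\<close>

definition left_bracket :: "('a \<times> 'a) set \<Rightarrow> 'a \<Rightarrow> 'a list \<Rightarrow> ('a trace \<Rightarrow>\<^sub>0 'k::comm_ring_1)" where
  "left_bracket \<theta> z bs = foldl (bracket (trace_monoid UNIV \<theta>)) (gen \<theta> z) (map (gen \<theta>) bs)"

lemma left_bracket_Nil: "left_bracket \<theta> z [] = gen \<theta> z"
  by (simp add: left_bracket_def)

lemma left_bracket_snoc:
  "left_bracket \<theta> z (bs @ [b]) = bracket (trace_monoid A \<theta>) (left_bracket \<theta> z bs) (gen \<theta> b)"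
  by (simp add: left_bracket_def bracket_trace_monoid[where A = UNIV and A' = A])

lemma left_bracket_in_algebra:
  "set (z # bs) \<subseteq> S \<Longrightarrow> left_bracket \<theta> z bs \<in> monoid_algebra (trace_monoid S \<theta>)"
proof (induction bs rule: rev_induct)
  case (snoc b bs)
  then show ?case
    by (auto simp: left_bracket_snoc[where A = S] gen_word_elt
        intro!: monoid_algebra_bracket monoid_algebra_word_elt)
qed (auto simp: left_bracket_Nil gen_word_elt intro!: monoid_algebra_word_elt)

lemma keys_mult_gen:
  "c \<in> Poly_Mapping.keys (alg_mult M f (gen \<theta> b)) \<Longrightarrow> \<exists>u\<in>Poly_Mapping.keys f. c = u \<otimes>\<^bsub>M\<^esub> letter \<theta> b"
  "c \<in> Poly_Mapping.keys (alg_mult M (gen \<theta> b) f) \<Longrightarrow> \<exists>u\<in>Poly_Mapping.keys f. c = letter \<theta> b \<otimes>\<^bsub>M\<^esub> u"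
  by (auto dest!: subsetD[OF keys_alg_mult] simp: gen_def)

lemma keys_bracket_gen:
  assumes "c \<in> Poly_Mapping.keys (bracket M f (gen \<theta> b))"
  shows "\<exists>u\<in>Poly_Mapping.keys f. c = u \<otimes>\<^bsub>M\<^esub> letter \<theta> b \<or> c = letter \<theta> b \<otimes>\<^bsub>M\<^esub> u"
  using subsetD[OF keys_diff assms[unfolded bracket_def]] by (auto dest!: keys_mult_gen)

text \<open>Iterated brackets are homogeneous in each letter, because both terms of a bracket with a letter
  are.\<close>

lemma keys_left_bracket:
  assumes "c \<in> Poly_Mapping.keys (left_bracket \<theta> z bs :: _ \<Rightarrow>\<^sub>0 'k::comm_ring_1)"
  shows "\<exists>w. c = trace_of \<theta> w \<and> mset w = mset (z # bs)"
  using assms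
proof (induction bs arbitrary: c rule: rev_induct)
  case Nil
  then have "c = trace_of \<theta> [z]" by (simp add: left_bracket_Nil gen_def letter_def)
  then show ?case by auto
next
  case (snoc b bs)
  from keys_bracket_gen[OF snoc.prems[unfolded left_bracket_snoc[where A = UNIV]]]
  obtain u where u: "u \<in> Poly_Mapping.keys (left_bracket \<theta> z bs :: _ \<Rightarrow>\<^sub>0 'k)"
    "c = u \<otimes>\<^bsub>trace_monoid UNIV \<theta>\<^esub> letter \<theta> b \<or> c = letter \<theta> b \<otimes>\<^bsub>trace_monoid UNIV \<theta>\<^esub> u" by blast
  from snoc.IH[OF u(1)] obtain w where w: "u = trace_of \<theta> w" "mset w = mset (z # bs)" by blast
  have "c = trace_of \<theta> (w @ [b]) \<or> c = trace_of \<theta> (b # w)"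
    using u(2) by (simp add: w letter_def trace_mult)
  moreover have "mset (w @ [b]) = mset (z # bs @ [b])" "mset (b # w) = mset (z # bs @ [b])"
    using w(2) by simp_all
  ultimately show ?case by blast
qed

locale partitioned_alphabet =
  fixes A B Z :: "'a set" and \<theta> :: "('a \<times> 'a) set"
  assumes independence: "independence_alphabet A \<theta>"
    and A_eq: "A = B \<union> Z" and disjoint: "B \<inter> Z = {}"
begin

lemma sym_\<theta>: "sym \<theta>" and irrefl_\<theta>: "(a, a) \<notin> \<theta>" and \<theta>_A: "(a, b) \<in> \<theta> \<Longrightarrow> a \<in> A \<and> b \<in> A"
  using independence by (auto simp: independence_alphabet_def irrefl_def)

abbreviation M :: "'a trace monoid" where "M \<equiv> trace_monoid A \<theta>"

abbreviation \<beta> :: "'a trace set" where "\<beta> \<equiv> beta A \<theta> Z B"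

text \<open>The words \<open>z # bs\<close> whose traces form \<open>\<beta>\<close>. A trace in \<open>\<beta>\<close> determines \<open>z\<close>, but \<open>bs\<close> only up to the
  congruence.\<close>

definition code_word :: "'a \<Rightarrow> 'a list \<Rightarrow> bool" where
  "code_word z bs \<longleftrightarrow> z \<in> Z \<and> bs \<in> lists B \<and> (\<forall>a. initial \<theta> a (z # bs) \<longrightarrow> a = z)"

lemma submonoid_gen_letters: "submonoid_gen M (letter \<theta> ` B) = trace_of \<theta> ` lists B"
proof
  have "submonoid (trace_of \<theta> ` lists B) M"
  proof
    show "trace_of \<theta> ` lists B \<subseteq> carrier M"
      using A_eq by (auto simp: carrier_trace_monoid)
  qed (auto simp: trace_mult one_trace_monoid intro!: imageI)
  then show "submonoid_gen M (letter \<theta> ` B) \<subseteq> trace_of \<theta> ` lists B"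
    unfolding submonoid_gen_def by (intro hull_minimal) (auto simp: letter_def)
  have "trace_of \<theta> w \<in> H" if H: "submonoid H M" "letter \<theta> ` B \<subseteq> H" and "w \<in> lists B" for H w
    using that(3)
  proof (induction w)
    case Nil
    show ?case using submonoid.one_closed[OF H(1)] by (simp add: one_trace_monoid)
  next
    case (Cons a w)
    have "letter \<theta> a \<otimes>\<^bsub>M\<^esub> trace_of \<theta> w \<in> H"
      using Cons H by (intro submonoid.m_closed[OF H(1)]) auto
    then show ?case by (simp add: letter_def trace_mult)
  qed
  then show "trace_of \<theta> ` lists B \<subseteq> submonoid_gen M (letter \<theta> ` B)"
    unfolding submonoid_gen_def hull_def by blast
qed

lemma code_word_beta: "code_word z bs \<Longrightarrow> trace_of \<theta> (z # bs) \<in> \<beta>"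
proof -
  assume *: "code_word z bs"
  then have "z # bs \<in> lists A" using A_eq by (auto simp: code_word_def)
  then have "IA A \<theta> (trace_of \<theta> (z # bs)) = {z}"
    using * by (auto simp: IA_trace_of[OF sym_\<theta>] code_word_def)
  moreover have "trace_of \<theta> (z # bs) = letter \<theta> z \<otimes>\<^bsub>M\<^esub> trace_of \<theta> bs"
    by (simp add: letter_def trace_mult)
  ultimately show ?thesis
    using * unfolding beta_def submonoid_gen_letters code_word_def by blast
qed

lemma betaE:
  assumes "x \<in> \<beta>"
  obtains z bs where "code_word z bs" "x = trace_of \<theta> (z # bs)"
proof -
  from assms obtain z bs where *: "z \<in> Z" "bs \<in> lists B"
      "x = letter \<theta> z \<otimes>\<^bsub>M\<^esub> trace_of \<theta> bs" "IA A \<theta> x = {z}"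
    unfolding beta_def submonoid_gen_letters by blast
  then have x: "x = trace_of \<theta> (z # bs)" by (simp add: letter_def trace_mult)
  have "z # bs \<in> lists A" using * A_eq by auto
  then have "{a. initial \<theta> a (z # bs)} = {z}"
    using *(4) unfolding x by (simp add: IA_trace_of[OF sym_\<theta>])
  then have "code_word z bs" using * unfolding code_word_def by blast
  with x show thesis by (rule that[rotated])
qed

lemma beta_imp_code_word:
  assumes "z \<in> Z" "bs \<in> lists B" "trace_of \<theta> (z # bs) \<in> \<beta>"
  shows "code_word z bs"
proof -
  obtain z' bs' where *: "code_word z' bs'" "trace_of \<theta> (z # bs) = trace_of \<theta> (z' # bs')"
    using betaE[OF assms(3)] by metis
  then have "initial \<theta> a (z # bs) \<longleftrightarrow> initial \<theta> a (z' # bs')" for a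
    by (intro initial_trace_eq[OF sym_\<theta>]) (simp add: trace_of_eq_iff)
  with *(1) assms(1,2) show ?thesis unfolding code_word_def by (metis initial.simps(2))
qed

lemma code_word_Nil: "z \<in> Z \<Longrightarrow> code_word z []"
  by (simp add: code_word_def)

text \<open>Appending \<open>b\<close> adds at most \<open>b\<close> to the letters that can be moved to the front, and it adds \<open>b\<close>
  exactly if \<open>b\<close> commutes with the whole word.\<close>

lemma code_word_snoc:
  "code_word z (bs @ [b]) \<longleftrightarrow> code_word z bs \<and> b \<in> B \<and> \<not> set (z # bs) \<times> {b} \<subseteq> \<theta>"
proof -
  have *: "initial \<theta> a (z # bs @ [b]) \<longleftrightarrow>
      initial \<theta> a (z # bs) \<or> (\<forall>c\<in>set (z # bs). (c, a) \<in> \<theta>) \<and> b = a" for a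
    using initial_append[of \<theta> a "z # bs" "[b]"] by simp
  show ?thesis
  proof (cases "z \<in> Z \<and> b \<in> B")
    case True
    then have "b \<noteq> z" using disjoint by blast
    with True show ?thesis
      unfolding code_word_def * by auto
  qed (auto simp: code_word_def)
qed

lemma code_word_unique:
  assumes "code_word z bs" "code_word z' bs'" "trace_eq \<theta> (z # bs) (z' # bs')"
  shows "z = z'" "trace_eq \<theta> bs bs'"
proof -
  have "initial \<theta> z (z' # bs')"
    using initial_trace_eq[OF sym_\<theta> assms(3), of z] by simp
  with assms(2) show "z = z'" unfolding code_word_def by blast
  with assms(3) show "trace_eq \<theta> bs bs'"
    using trace_eq_cancel_left[of \<theta> "[z]" bs bs'] by simp
qed

lemma code_word_set: "code_word z bs \<Longrightarrow> set (z # bs) \<subseteq> A"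
  using A_eq by (auto simp: code_word_def)

lemma tau_eq: "tau A \<theta> Z B = {left_bracket \<theta> z bs | z bs. code_word z bs}"
proof -
  have "code_word z bs \<longleftrightarrow> z \<in> Z \<and> bs \<in> lists B \<and> trace_of \<theta> (z # bs) \<in> \<beta>" for z bs
    using code_word_beta beta_imp_code_word unfolding code_word_def by metis
  then show ?thesis
    by (simp add: tau_def left_bracket_def bracket_trace_monoid[where A = A and A' = UNIV])
qed

lemma left_bracket_in_tau: "code_word z bs \<Longrightarrow> left_bracket \<theta> z bs \<in> tau A \<theta> Z B"
  unfolding tau_eq mem_Collect_eq by (rule exI[of _ z], rule exI[of _ bs]) simp

lemma tau_in_algebra: "tau A \<theta> Z B \<subseteq> monoid_algebra M"
  by (auto simp only: tau_eq intro!: left_bracket_in_algebra dest!: code_word_set)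

lemma left_bracket_commute:
  assumes "set (z # bs) \<times> set (z' # bs') \<subseteq> \<theta>"
  shows "bracket M (left_bracket \<theta> z bs) (left_bracket \<theta> z' bs') = 0"
  by (rule bracket_eq_0_if_alphabets_commute[OF left_bracket_in_algebra left_bracket_in_algebra assms])
    (rule order_refl)+

lemma left_bracket_commute_letter:
  assumes "set (z # bs) \<times> {b} \<subseteq> \<theta>"
  shows "bracket M (left_bracket \<theta> z bs) (gen \<theta> b) = 0"
  by (rule bracket_eq_0_if_alphabets_commute[OF left_bracket_in_algebra _ assms])
    (auto simp: gen_word_elt intro!: monoid_algebra_word_elt)

section \<open>The ideal and the direct decomposition\<close>

definition J :: "('a trace \<Rightarrow>\<^sub>0 'k::comm_ring_1) set" where
  "J = lie_gen M (tau A \<theta> Z B)"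

lemmas J_closed = lie_subalgebraD[OF lie_subalgebra_lie_gen[OF tau_in_algebra], folded J_def]

lemmas L_closed =
  lie_subalgebraD[OF lie_subalgebra_lie_gen[OF gens_in_algebra[OF order_refl]], folded free_pc_lie_def]

lemmas J_induct = lie_gen_induct[OF _ tau_in_algebra, folded J_def,
  consumes 1, case_names generator zero add scale bracket]

lemmas L_induct = lie_gen_induct[OF _ gens_in_algebra[OF order_refl], folded free_pc_lie_def,
  consumes 1, case_names generator zero add scale bracket]

lemma tau_subset_J: "tau A \<theta> Z B \<subseteq> J"
  unfolding J_def by (rule lie_gen_superset)

lemma gen_in_L: "a \<in> A \<Longrightarrow> gen \<theta> a \<in> free_pc_lie A \<theta>"
  unfolding free_pc_lie_def using lie_gen_superset by blast

lemma left_bracket_in_L: "set (z # bs) \<subseteq> A \<Longrightarrow> left_bracket \<theta> z bs \<in> free_pc_lie A \<theta>"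
proof (induction bs rule: rev_induct)
  case (snoc b bs)
  then show ?case by (auto simp: left_bracket_snoc[where A = A] intro!: L_closed gen_in_L)
qed (auto simp: left_bracket_Nil intro!: gen_in_L)

lemma J_subset_L: "J \<subseteq> free_pc_lie A \<theta>"
proof -
  have "tau A \<theta> Z B \<subseteq> free_pc_lie A \<theta>"
    by (auto simp only: tau_eq intro!: left_bracket_in_L dest!: code_word_set)
  then show ?thesis
    unfolding J_def by (rule lie_gen_minimal) (intro lie_subalgebraI L_closed; assumption)
qed

lemma gen_Z_in_tau: "z \<in> Z \<Longrightarrow> gen \<theta> z \<in> tau A \<theta> Z B"
  unfolding tau_eq left_bracket_Nil[symmetric] using code_word_Nil by blast

text \<open>Bracketing with \<open>b\<close> is a derivation, so only the generators of \<open>J\<close> matter. Such a generator goes to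
  the generator of the extended code word if there is one, and otherwise \<open>b\<close> commutes with all its
  letters and it goes to \<open>0\<close>.\<close>

lemma bracket_J_letter:
  assumes "y \<in> J" "b \<in> B"
  shows "bracket M y (gen \<theta> b) \<in> J"
  using assms(1)
proof (induction rule: J_induct)
  case (generator t)
  then obtain z bs where t: "t = left_bracket \<theta> z bs" "code_word z bs"
    unfolding tau_eq by blast
  show ?case
  proof (cases "set (z # bs) \<times> {b} \<subseteq> \<theta>")
    case True
    then show ?thesis by (simp add: t left_bracket_commute_letter J_closed)
  next
    case False
    then have "code_word z (bs @ [b])" using t assms(2) by (simp add: code_word_snoc)
    then have "left_bracket \<theta> z (bs @ [b]) \<in> tau A \<theta> Z B" unfolding tau_eq by blast
    then show ?thesis using tau_subset_J by (auto simp: t left_bracket_snoc[where A = A])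
  qed
next
  case (bracket x y)
  then show ?case
    by (simp add: bracket_derivation[of _ _ x y] J_closed(3,6))
qed (simp_all add: bracket_distribs J_closed)

lemma bracket_L_J:
  assumes "x \<in> free_pc_lie A \<theta>" "y \<in> J"
  shows "bracket M x y \<in> J"
  using assms
proof (induction arbitrary: y rule: L_induct)
  case (generator x)
  then obtain a where a: "x = gen \<theta> a" "a \<in> A" by blast
  show ?case
  proof (cases "a \<in> B")
    case True
    then show ?thesis
      unfolding a bracket_swap[of _ "gen \<theta> a"] using generator by (intro J_closed bracket_J_letter)
  next
    case False
    then have "gen \<theta> a \<in> J" using gen_Z_in_tau tau_subset_J a A_eq by blast
    with generator show ?thesis unfolding a by (intro J_closed)
  qed
next
  case (bracket x x')
  have "bracket M x (bracket M x' y) + bracket M (bracket M x y) x' = bracket M (bracket M x x') y"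
    using bracket_derivation[of A \<theta> x x' y] by simp
  moreover have "bracket M (bracket M x y) x' = - bracket M x' (bracket M x y)"
    by (rule bracket_swap)
  ultimately show ?case using bracket J_closed by metis
qed (simp_all add: bracket_distribs J_closed)

lemma lie_ideal_J: "lie_ideal M (free_pc_lie A \<theta>) J"
  by (simp add: lie_ideal_def smult.subspace_def J_subset_L bracket_L_J J_closed)

abbreviation L_B :: "('a trace \<Rightarrow>\<^sub>0 'k::comm_ring_1) set" where
  "L_B \<equiv> lie_gen M (gen \<theta> ` B)"

lemma B_subset_A: "B \<subseteq> A" using A_eq by blast

lemmas L_B_closed = lie_subalgebraD[OF lie_subalgebra_lie_gen[OF gens_in_algebra[OF B_subset_A]]]

lemma L_B_subset_L: "L_B \<subseteq> free_pc_lie A \<theta>"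
  using B_subset_A unfolding free_pc_lie_def lie_gen_def by (intro hull_mono) blast

text \<open>Since \<open>J\<close> is an ideal, the sum is a Lie subalgebra, and it contains all letters.\<close>

lemma L_eq_sum: "free_pc_lie A \<theta> = {u + v | u v. u \<in> L_B \<and> v \<in> J}" (is "_ = ?S")
proof
  show S: "?S \<subseteq> free_pc_lie A \<theta>"
    using subsetD[OF L_B_subset_L] subsetD[OF J_subset_L] by (auto intro: L_closed(3))
  have "lie_subalgebra M ?S"
  proof (rule lie_subalgebraI)
    fix x assume "x \<in> ?S"
    then show "x \<in> monoid_algebra M"
      using S by (intro L_closed(1)) blast
  next
    have "0 = 0 + (0 :: 'a trace \<Rightarrow>\<^sub>0 'b)" by simp
    with L_B_closed(2) J_closed(2) show "0 \<in> ?S" unfolding mem_Collect_eq by (intro exI conjI)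
  next
    fix x y assume "x \<in> ?S" "y \<in> ?S"
    then obtain u v u' v' where
      *: "u \<in> L_B" "v \<in> J" "u' \<in> L_B" "v' \<in> J" "x = u + v" "y = u' + v'" by blast
    have "x + y = (u + u') + (v + v')" by (simp add: * algebra_simps)
    moreover have "u + u' \<in> L_B" "v + v' \<in> J" using * by (simp_all add: L_B_closed J_closed)
    ultimately show "x + y \<in> ?S" unfolding mem_Collect_eq by (intro exI conjI)
    have "bracket M x y = bracket M u u' + (bracket M u v' + (- bracket M u' v + bracket M v v'))"
      unfolding *(5,6) bracket_distribs bracket_swap[of M v u'] by (simp add: algebra_simps)
    moreover have "bracket M u u' \<in> L_B" using * by (simp add: L_B_closed)
    moreover have "bracket M u v' \<in> J" "bracket M u' v \<in> J"
      using bracket_L_J[OF subsetD[OF L_B_subset_L *(1)] *(4)]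
        bracket_L_J[OF subsetD[OF L_B_subset_L *(3)] *(2)] by simp_all
    then have "bracket M u v' + (- bracket M u' v + bracket M v v') \<in> J"
      using * by (intro J_closed(3)) (simp_all add: J_closed)
    ultimately show "bracket M x y \<in> ?S" unfolding mem_Collect_eq by (intro exI conjI)
  next
    fix c x assume "x \<in> ?S"
    then obtain u v where *: "u \<in> L_B" "v \<in> J" "x = u + v" by blast
    have "smult c x = smult c u + smult c v" by (simp add: * smult.scale_right_distrib)
    moreover have "smult c u \<in> L_B" "smult c v \<in> J" using * by (simp_all add: L_B_closed J_closed)
    ultimately show "smult c x \<in> ?S" unfolding mem_Collect_eq by (intro exI conjI)
  qed
  moreover have "gen \<theta> ` A \<subseteq> ?S"
  proof
    fix x :: "'a trace \<Rightarrow>\<^sub>0 'b" assume "x \<in> gen \<theta> ` A"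
    then obtain a where a: "x = gen \<theta> a" "a \<in> A" by blast
    show "x \<in> ?S"
    proof (cases "a \<in> B")
      case True
      then have "gen \<theta> a \<in> L_B" using lie_gen_superset by blast
      moreover have "x = gen \<theta> a + 0" by (simp add: a)
      ultimately show ?thesis using J_closed(2) unfolding mem_Collect_eq by (intro exI conjI)
    next
      case False
      then have "gen \<theta> a \<in> J" using gen_Z_in_tau tau_subset_J a A_eq by blast
      moreover have "x = 0 + gen \<theta> a" by (simp add: a)
      ultimately show ?thesis using L_B_closed(2) unfolding mem_Collect_eq by (intro exI conjI)
    qed
  qed
  ultimately show "free_pc_lie A \<theta> \<subseteq> ?S"
    unfolding free_pc_lie_def by (intro lie_gen_minimal)
qed

text \<open>This subalgebra contains the generators of \<open>J\<close>, hence \<open>J\<close>; it meets the algebra of traces over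
  \<open>B\<close> only in \<open>0\<close>.\<close>

lemma lie_subalgebra_Z_support:
  "lie_subalgebra M {f \<in> monoid_algebra M. \<forall>c\<in>Poly_Mapping.keys f. Alph c \<inter> Z \<noteq> {}}"
    (is "lie_subalgebra M ?S")
proof -
  have mult: "Alph c \<inter> Z \<noteq> {}"
    if fgc: "f \<in> ?S" "g \<in> ?S" "c \<in> Poly_Mapping.keys (alg_mult M f g)"
    for f g :: "'a trace \<Rightarrow>\<^sub>0 'b" and c
  proof -
    obtain u v where c: "c = u \<otimes>\<^bsub>M\<^esub> v" and uv: "u \<in> Poly_Mapping.keys f" "v \<in> Poly_Mapping.keys g"
      using subsetD[OF keys_alg_mult fgc(3)] unfolding mem_Collect_eq by (elim exE conjE)
    have "u \<in> trace_of \<theta> ` lists A" "v \<in> trace_of \<theta> ` lists A"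
      using fgc(1,2) uv by (simp_all add: monoid_algebra_def carrier_trace_monoid subset_eq)
    then obtain w w' where ww': "u = trace_of \<theta> w" "v = trace_of \<theta> w'" by blast
    have "Alph c = Alph u \<union> Alph v"
      by (simp add: c ww' trace_mult Alph_trace_of)
    moreover have "Alph u \<inter> Z \<noteq> {}" using fgc(1) uv by simp
    ultimately show ?thesis by blast
  qed
  show ?thesis
  proof (rule lie_subalgebraI)
    fix x y :: "'a trace \<Rightarrow>\<^sub>0 'b" assume xy: "x \<in> ?S" "y \<in> ?S"
    then have "x + y \<in> monoid_algebra M"
      by (simp add: smult.subspace_add[OF subspace_monoid_algebra])
    moreover have "Alph c \<inter> Z \<noteq> {}" if "c \<in> Poly_Mapping.keys (x + y)" for c
      using subsetD[OF keys_add that] xy by auto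
    ultimately show "x + y \<in> ?S" by simp
    have "bracket M x y \<in> monoid_algebra M" using xy by (auto intro: monoid_algebra_bracket)
    moreover have "Poly_Mapping.keys (bracket M x y)
        \<subseteq> Poly_Mapping.keys (alg_mult M x y) \<union> Poly_Mapping.keys (alg_mult M y x)"
      unfolding bracket_def by (rule keys_diff)
    ultimately show "bracket M x y \<in> ?S" using mult[OF xy] mult[OF xy(2,1)] by auto
  next
    fix c and x :: "'a trace \<Rightarrow>\<^sub>0 'b" assume "x \<in> ?S"
    then show "smult c x \<in> ?S"
      using subsetD[OF keys_smult[of c x]] by (simp add: smult.subspace_scale[OF subspace_monoid_algebra])
  qed (simp_all add: monoid_algebra_def)
qed

lemma keys_tau:
  assumes "x \<in> tau A \<theta> Z B" "c \<in> Poly_Mapping.keys x"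
  shows "Alph c \<inter> Z \<noteq> {}"
proof -
  from assms(1) obtain z bs where x: "x = left_bracket \<theta> z bs" and z: "code_word z bs"
    unfolding tau_eq by blast
  obtain w where "c = trace_of \<theta> w" "mset w = mset (z # bs)"
    using keys_left_bracket[OF assms(2)[unfolded x]] by blast
  then have "z \<in> Alph c" using mset_eq_setD by (fastforce simp: Alph_trace_of)
  with z show ?thesis by (auto simp: code_word_def)
qed

lemma L_B_inter_J: "L_B \<inter> J = {0}"
proof -
  have J: "J \<subseteq> {f \<in> monoid_algebra M. \<forall>c\<in>Poly_Mapping.keys f. Alph c \<inter> Z \<noteq> {}}"
    unfolding J_def
  proof (rule lie_gen_minimal[OF _ lie_subalgebra_Z_support], rule subsetI)
    fix x assume x: "x \<in> tau A \<theta> Z B"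
    show "x \<in> {f \<in> monoid_algebra M. \<forall>c\<in>Poly_Mapping.keys f. Alph c \<inter> Z \<noteq> {}}"
      using keys_tau[OF x] subsetD[OF tau_in_algebra x] by simp
  qed
  have "lie_subalgebra M (monoid_algebra (trace_monoid B \<theta>))"
    using lie_subalgebraD[OF lie_subalgebra_monoid_algebra[of B \<theta>]]
    by (intro lie_subalgebraI monoid_algebra_mono[OF _ B_subset_A])
      (simp_all add: bracket_trace_monoid[where A = A and A' = B])
  then have L: "L_B \<subseteq> monoid_algebra (trace_monoid B \<theta>)"
    by (intro lie_gen_minimal gens_in_algebra) auto
  have "f = 0" if f: "f \<in> L_B" "f \<in> J" for f
  proof -
    have "c \<notin> Poly_Mapping.keys f" for c
    proof
      assume c: "c \<in> Poly_Mapping.keys f"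
      then obtain w where w: "w \<in> lists B" "c = trace_of \<theta> w"
        using subsetD[OF L f(1)] by (auto simp: monoid_algebra_def carrier_trace_monoid)
      have "Alph c \<inter> Z \<noteq> {}" using subsetD[OF J f(2)] c by simp
      then show False using w disjoint by (auto simp: Alph_trace_of)
    qed
    then have "Poly_Mapping.keys f = {}" by blast
    then show ?thesis by simp
  qed
  then show ?thesis using L_B_closed(2) J_closed(2) by blast
qed

lemma direct_sum_L: "direct_sum (free_pc_lie A \<theta>) L_B J"
  unfolding direct_sum_def
  by (intro conjI L_eq_sum L_B_inter_J) (simp_all add: smult.subspace_def L_B_closed J_closed)

end

section \<open>Extending codes by letters\<close>

context partitioned_alphabet
begin

text \<open>The combinatorial form of the TFSA property: two codes with commuting alphabets cannot both be
  extended by the same letter.\<close>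

definition no_common_extension :: bool where
  "no_common_extension \<longleftrightarrow>
     (\<forall>z bs z' bs' b. code_word z (bs @ [b]) \<longrightarrow> code_word z' (bs' @ [b]) \<longrightarrow>
        \<not> set (z # bs) \<times> set (z' # bs') \<subseteq> \<theta>)"

end

text \<open>The elements of \<open>\<beta>\<close> serve as letters of a new alphabet \<open>X\<close>. They are encoded by an arbitrary
  function \<open>cw\<close> that is injective on traces, since two copies of this alphabet occur: the traces
  themselves, and the iterated brackets, which are the letters for which \<open>J\<close> is free. The scalar \<open>q\<close>
  is the twist of the derivations below.\<close>

locale encoded_codes = partitioned_alphabet A B Z \<theta>
  for A B Z :: "'a set" and \<theta> +
  fixes cw :: "'a \<Rightarrow> 'a list \<Rightarrow> 'x" and q :: "'k::comm_ring_1"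
  assumes cw_eq_iff: "code_word z bs \<Longrightarrow> code_word z' bs' \<Longrightarrow>
      cw z bs = cw z' bs' \<longleftrightarrow> trace_eq \<theta> (z # bs) (z' # bs')"
    and no_common_extension
begin

definition X :: "'x set" where
  "X = {cw z bs | z bs. code_word z bs}"

definition \<theta>X :: "('x \<times> 'x) set" where
  "\<theta>X = {(cw z bs, cw z' bs') | z bs z' bs'.
     code_word z bs \<and> code_word z' bs' \<and> set (z # bs) \<times> set (z' # bs') \<subseteq> \<theta>}"

text \<open>Appending \<open>b\<close> to the code \<open>x\<close>, with value \<open>None\<close> if the result is not a code. The choice is over
  the words that represent \<open>x\<close>, and its result does not depend on them (\<open>extend_cw\<close>).\<close>

definition extend :: "'a \<Rightarrow> 'x \<Rightarrow> 'x option" where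
  "extend b x = (if \<exists>z bs. x = cw z bs \<and> code_word z (bs @ [b])
     then Some (SOME y. \<exists>z bs. x = cw z bs \<and> code_word z (bs @ [b]) \<and> y = cw z (bs @ [b]))
     else None)"

lemma code_word_butlast: "code_word z (bs @ [b]) \<Longrightarrow> code_word z bs"
  by (simp add: code_word_snoc)

lemma extend_cw:
  assumes "code_word z bs"
  shows "extend b (cw z bs) = (if code_word z (bs @ [b]) then Some (cw z (bs @ [b])) else None)"
proof -
  have *: "code_word z (bs @ [b]) \<and> cw z' (bs' @ [b]) = cw z (bs @ [b])"
    if "cw z bs = cw z' bs'" and c: "code_word z' (bs' @ [b])" for z' bs'
  proof -
    have eq: "trace_eq \<theta> (z # bs) (z' # bs')"
      using that code_word_butlast assms cw_eq_iff by blast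
    then have "set (z # bs) = set (z' # bs')" by (rule trace_eq_set)
    then have cz: "code_word z (bs @ [b])"
      using assms c by (simp only: code_word_snoc simp_thms)
    have "trace_eq \<theta> (z' # bs' @ [b]) (z # bs @ [b])"
      using trace_eq_append_right[OF trace_eq.sym[OF eq], of "[b]"] by simp
    with cz c show ?thesis by (simp add: cw_eq_iff)
  qed
  show ?thesis
  proof (cases "code_word z (bs @ [b])")
    case True
    then have "(SOME y. \<exists>z' bs'. cw z bs = cw z' bs' \<and> code_word z' (bs' @ [b]) \<and> y = cw z' (bs' @ [b]))
        = cw z (bs @ [b])"
      by (intro some_equality) (use * in blast)+
    with True show ?thesis unfolding extend_def by auto
  next
    case False
    with * show ?thesis unfolding extend_def by auto
  qed
qed

lemma X_cases:
  assumes "x \<in> X" obtains z bs where "code_word z bs" "x = cw z bs"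
  using assms unfolding X_def by blast

lemma cw_in_X: "code_word z bs \<Longrightarrow> cw z bs \<in> X"
  unfolding X_def by blast

lemma extend_in_X: "x \<in> X \<Longrightarrow> extend b x = Some y \<Longrightarrow> y \<in> X"
  by (erule X_cases) (auto simp: extend_cw cw_in_X split: if_splits)

lemma cw_\<theta>X_iff:
  assumes "code_word z bs" "code_word z' bs'"
  shows "(cw z bs, cw z' bs') \<in> \<theta>X \<longleftrightarrow> set (z # bs) \<times> set (z' # bs') \<subseteq> \<theta>"
proof
  assume "(cw z bs, cw z' bs') \<in> \<theta>X"
  then obtain y cs y' cs' where *: "cw z bs = cw y cs" "cw z' bs' = cw y' cs'"
    "code_word y cs" "code_word y' cs'" "set (y # cs) \<times> set (y' # cs') \<subseteq> \<theta>"
    unfolding \<theta>X_def by blast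
  then have "trace_eq \<theta> (z # bs) (y # cs)" "trace_eq \<theta> (z' # bs') (y' # cs')"
    using assms by (simp_all add: cw_eq_iff)
  with *(5) show "set (z # bs) \<times> set (z' # bs') \<subseteq> \<theta>"
    by (simp only: trace_eq_set)
qed (use assms in \<open>unfold \<theta>X_def, blast\<close>)

lemma \<theta>X_X: "(x, y) \<in> \<theta>X \<Longrightarrow> x \<in> X \<and> y \<in> X"
  unfolding \<theta>X_def X_def by blast

lemma sym_\<theta>X: "(x, y) \<in> \<theta>X \<Longrightarrow> (y, x) \<in> \<theta>X"
  unfolding \<theta>X_def using sym_\<theta> by (blast dest: symD)

lemma independence_X: "independence_alphabet X \<theta>X"
proof -
  have "(x, x) \<notin> \<theta>X" for x
  proof
    assume xx: "(x, x) \<in> \<theta>X"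
    then obtain z bs where "code_word z bs" "x = cw z bs" using \<theta>X_X X_cases by metis
    with xx have "set (z # bs) \<times> set (z # bs) \<subseteq> \<theta>" by (simp only: cw_\<theta>X_iff)
    then show False using irrefl_\<theta>[of z] by auto
  qed
  then show ?thesis
    unfolding independence_alphabet_def using \<theta>X_X sym_\<theta>X by (auto intro: symI irreflI)
qed

text \<open>This is where the condition on common extensions enters. Of two commuting codes at most one can
  be extended by \<open>b\<close>; the other one then commutes with \<open>b\<close>, hence also with the extended code.\<close>

lemma extend_commuting:
  assumes "(x, y) \<in> \<theta>X" "extend b x = Some x'"
  shows "extend b y = None" "(x', y) \<in> \<theta>X"
proof -
  obtain z bs where x: "code_word z bs" "x = cw z bs" using \<theta>X_X[OF assms(1)] X_cases by metis
  obtain z' bs' where y: "code_word z' bs'" "y = cw z' bs'" using \<theta>X_X[OF assms(1)] X_cases by metis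
  have c: "set (z # bs) \<times> set (z' # bs') \<subseteq> \<theta>" using assms(1) x y by (simp only: cw_\<theta>X_iff)
  have b: "code_word z (bs @ [b])" "x' = cw z (bs @ [b])"
    using assms(2) x by (auto simp: extend_cw split: if_splits)
  have ny: "\<not> code_word z' (bs' @ [b])"
    using encoded_codes_axioms b(1) c
    unfolding encoded_codes_def encoded_codes_axioms_def no_common_extension_def by blast
  then show "extend b y = None" using y by (simp add: extend_cw)
  have "set (z' # bs') \<times> {b} \<subseteq> \<theta>"
    using ny y(1) b(1) by (auto simp: code_word_snoc)
  then have "set (z # bs @ [b]) \<times> set (z' # bs') \<subseteq> \<theta>"
    using c sym_\<theta> by (auto dest: symD)
  then show "(x', y) \<in> \<theta>X" using b y by (simp add: cw_\<theta>X_iff)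
qed

text \<open>If \<open>b\<close> and \<open>b'\<close> commute, then the two extensions can be made in either order, and one of them does
  not affect whether the other one is possible.\<close>

lemma extend_letters:
  assumes "(b, b') \<in> \<theta>" "x \<in> X"
  shows "Option.bind (extend b x) (extend b') = Option.bind (extend b' x) (extend b)"
    and "extend b' x = Some y \<Longrightarrow> extend b y = None \<longleftrightarrow> extend b x = None"
proof -
  obtain z bs where x: "code_word z bs" "x = cw z bs" using assms(2) X_cases by metis
  have b'b: "(b', b) \<in> \<theta>" using assms(1) sym_\<theta> by (rule symD[rotated])
  have *: "code_word z ((bs @ [b]) @ [b']) \<longleftrightarrow> code_word z (bs @ [b]) \<and> code_word z (bs @ [b'])"
    "code_word z ((bs @ [b']) @ [b]) \<longleftrightarrow> code_word z (bs @ [b]) \<and> code_word z (bs @ [b'])"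
    using assms(1) b'b by (auto simp only: code_word_snoc set_append list.set simp: insert_Times_insert)
  have "trace_eq \<theta> (z # (bs @ [b]) @ [b']) (z # (bs @ [b']) @ [b])"
    using trace_eq.swap[OF assms(1), of "z # bs" "[]"] by simp
  then have "cw z ((bs @ [b]) @ [b']) = cw z ((bs @ [b']) @ [b])"
    if "code_word z ((bs @ [b]) @ [b'])" "code_word z ((bs @ [b']) @ [b])"
    using cw_eq_iff[OF that] by simp
  then show "Option.bind (extend b x) (extend b') = Option.bind (extend b' x) (extend b)"
    unfolding x(2) using x(1) * by (simp add: extend_cw del: append_assoc)
  show "extend b y = None \<longleftrightarrow> extend b x = None" if "extend b' x = Some y"
    using that unfolding x(2) using x(1) *(2)
    by (auto simp: extend_cw simp del: append_assoc split: if_splits)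
qed

lemma extend_letter: "z \<in> Z \<Longrightarrow> (z, b) \<in> \<theta> \<Longrightarrow> extend b (cw z []) = None"
  using code_word_snoc[of z "[]" b] by (simp add: extend_cw code_word_Nil)

section \<open>The twisted derivations and the action of the algebra of traces\<close>

abbreviation N :: "'x trace monoid" where "N \<equiv> trace_monoid X \<theta>X"

abbreviation V :: "('x trace \<Rightarrow>\<^sub>0 'k) set" where "V \<equiv> monoid_algebra N"

abbreviation nmult :: "('x trace \<Rightarrow>\<^sub>0 'k) \<Rightarrow> ('x trace \<Rightarrow>\<^sub>0 'k) \<Rightarrow> ('x trace \<Rightarrow>\<^sub>0 'k)" (infixl "\<star>" 70) where
  "f \<star> g \<equiv> alg_mult N f g"

definition next_gen :: "'a \<Rightarrow> 'x \<Rightarrow> ('x trace \<Rightarrow>\<^sub>0 'k)" where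
  "next_gen b x = (case extend b x of None \<Rightarrow> 0 | Some y \<Rightarrow> gen \<theta>X y)"

text \<open>The value is the scalar by which the operator of \<open>b\<close> is multiplied when it passes the code \<open>x\<close> from
  the right to the left: \<open>1\<close> if \<open>b\<close> commutes with \<open>x\<close>, and \<open>q\<close> otherwise.\<close>

definition weight :: "'a \<Rightarrow> 'x \<Rightarrow> 'k" where
  "weight b x = (if extend b x = None then 1 else q)"

text \<open>On a word of codes, the sum over all positions of the words in which the code at this position is
  extended by \<open>b\<close>, with the weights of all later codes as coefficient.\<close>

primrec deriv_word :: "'a \<Rightarrow> 'x list \<Rightarrow> ('x trace \<Rightarrow>\<^sub>0 'k)" where
  "deriv_word b [] = 0"
| "deriv_word b (x # xs) =
     smult (prod_list (map (weight b) xs)) (next_gen b x \<star> word_elt \<theta>X xs) + gen \<theta>X x \<star> deriv_word b xs"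

lemma next_gen_in_algebra: "next_gen b x \<in> monoid_algebra (trace_monoid UNIV \<theta>X)"
  by (auto simp: next_gen_def gen_word_elt smult.subspace_0[OF subspace_monoid_algebra]
      intro: monoid_algebra_word_elt split: option.split)

lemma deriv_word_in_algebra: "deriv_word b xs \<in> monoid_algebra (trace_monoid UNIV \<theta>X)"
  by (induction xs) (auto simp: gen_word_elt smult.subspace_0[OF subspace_monoid_algebra]
      intro!: smult.subspace_add[OF subspace_monoid_algebra] smult.subspace_scale[OF subspace_monoid_algebra]
        monoid_algebra_mult next_gen_in_algebra monoid_algebra_word_elt)

lemma next_gen_in_V: "x \<in> X \<Longrightarrow> next_gen b x \<in> V"
  by (auto simp: next_gen_def gen_word_elt smult.subspace_0[OF subspace_monoid_algebra] extend_in_X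
      intro!: monoid_algebra_word_elt split: option.split)

lemma deriv_word_in_V: "xs \<in> lists X \<Longrightarrow> deriv_word b xs \<in> V"
  by (induction xs) (auto simp: gen_word_elt smult.subspace_0[OF subspace_monoid_algebra]
      intro!: smult.subspace_add[OF subspace_monoid_algebra] smult.subspace_scale[OF subspace_monoid_algebra]
        monoid_algebra_mult next_gen_in_V monoid_algebra_word_elt)

lemma deriv_word_append:
  "deriv_word b (xs @ ys) =
     smult (prod_list (map (weight b) ys)) (deriv_word b xs \<star> word_elt \<theta>X ys) +
     word_elt \<theta>X xs \<star> deriv_word b ys"
proof (induction xs)
  case Nil
  show ?case by (simp add: alg_mult_distribs alg_mult_one_left[OF deriv_word_in_algebra])
next
  case (Cons x xs)
  have "word_elt \<theta>X (x # xs) = gen \<theta>X x \<star> word_elt \<theta>X xs"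
    by (simp add: gen_word_elt word_elt_mult)
  moreover have "word_elt \<theta>X (xs @ ys) = word_elt \<theta>X xs \<star> word_elt \<theta>X ys"
    by (simp add: word_elt_mult)
  ultimately show ?case
    by (simp add: Cons alg_mult_distribs alg_mult_trace_assoc smult.scale_right_distrib mult.commute)
qed

lemma deriv_word_single: "deriv_word b [x] = next_gen b x"
  by (simp add: alg_mult_one_right[OF next_gen_in_algebra] alg_mult_distribs)

lemma commute_gens: "(x, y) \<in> \<theta>X \<Longrightarrow> gen \<theta>X x \<star> gen \<theta>X y = gen \<theta>X y \<star> gen \<theta>X x"
  by (simp add: gen_word_elt word_elt_mult word_elt_eq_iff trace_eq_swap_first)

lemma deriv_word_pair:
  "deriv_word b [x, y] = smult (weight b y) (next_gen b x \<star> gen \<theta>X y) + gen \<theta>X x \<star> next_gen b y"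
  using deriv_word_append[of b "[x]" "[y]"] unfolding deriv_word_single by (simp add: gen_word_elt)

text \<open>If \<open>x\<close> can be extended, then \<open>y\<close> has weight \<open>1\<close> and is not extended, so both sides are the product of
  \<open>y\<close> and the extension of \<open>x\<close>, and these two commute.\<close>

lemma deriv_word_pair_commute:
  assumes "(x, y) \<in> \<theta>X"
  shows "deriv_word b [x, y] = deriv_word b [y, x]"
proof -
  have *: "deriv_word b [x, y] = deriv_word b [y, x]"
    if xy: "(x, y) \<in> \<theta>X" and x': "extend b x = Some x'" for x y x'
  proof -
    note e = extend_commuting[OF xy x']
    show ?thesis
      unfolding deriv_word_pair
      by (simp add: next_gen_def weight_def x' e(1) alg_mult_distribs commute_gens[OF e(2)])
  qed
  show ?thesis
  proof (cases "extend b x")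
    case None
    show ?thesis
    proof (cases "extend b y")
      case None
      with \<open>extend b x = None\<close> show ?thesis
        unfolding deriv_word_pair by (simp add: next_gen_def alg_mult_distribs)
    next
      case (Some y')
      then show ?thesis using *[OF sym_\<theta>X[OF assms]] by simp
    qed
  next
    case (Some x')
    then show ?thesis using *[OF assms] by simp
  qed
qed

lemma deriv_word_swap:
  assumes "(x, y) \<in> \<theta>X"
  shows "deriv_word b (us @ [x, y] @ vs) = deriv_word b (us @ [y, x] @ vs)"
proof -
  have "word_elt \<theta>X ([x, y] @ vs) = (word_elt \<theta>X ([y, x] @ vs) :: _ \<Rightarrow>\<^sub>0 'k)"
    using trace_eq.swap[OF assms, of "[]" vs] by (simp add: word_elt_eq_iff)
  moreover have "word_elt \<theta>X [x, y] = (word_elt \<theta>X [y, x] :: _ \<Rightarrow>\<^sub>0 'k)"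
    using trace_eq.swap[OF assms, of "[]" "[]"] by (simp add: word_elt_eq_iff)
  ultimately show ?thesis
    unfolding deriv_word_append[of b us] deriv_word_append[of b "[_, _]"]
      deriv_word_pair_commute[OF assms]
    by (simp only: map_append prod_list.append list.map prod_list.Cons mult.left_commute)
qed

definition D :: "'a \<Rightarrow> ('x trace \<Rightarrow>\<^sub>0 'k) \<Rightarrow> ('x trace \<Rightarrow>\<^sub>0 'k)" where
  "D b = linear_extension (on_trace (deriv_word b))"

lemma klinear_D: "klinear (D b)"
  unfolding D_def by (rule klinear_linear_extension)

lemmas D_linear = module_hom.add[OF klinear_D] module_hom.scale[OF klinear_D]
  module_hom.zero[OF klinear_D]

lemma D_word_elt: "D b (word_elt \<theta>X w) = deriv_word b w"
  unfolding D_def word_elt_def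
  by (simp add: linear_extension_single
      on_trace_trace_of[where F = "deriv_word b" and \<theta> = \<theta>X, OF deriv_word_swap])

lemma D_in_V: "f \<in> V \<Longrightarrow> D b f \<in> V"
  by (rule klinear_image_words[OF klinear_D _ _ subspace_monoid_algebra], assumption)
    (simp only: D_word_elt deriv_word_in_V)

lemma D_mult_gen:
  assumes "f \<in> V"
  shows "D b (f \<star> gen \<theta>X x) = f \<star> next_gen b x + smult (weight b x) (D b f \<star> gen \<theta>X x)"
proof (rule klinear_cong_words[OF _ _ assms])
  show "klinear (\<lambda>f. D b (f \<star> gen \<theta>X x))"
    by (rule klinear_comp[OF klinear_D klinear_alg_mult_left])
  show "klinear (\<lambda>f. f \<star> next_gen b x + smult (weight b x) (D b f \<star> gen \<theta>X x))"
    by (simp add: klinear_iff alg_mult_distribs D_linear smult.scale_right_distrib algebra_simps)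
next
  fix w
  show "D b (word_elt \<theta>X w \<star> gen \<theta>X x) =
      word_elt \<theta>X w \<star> next_gen b x + smult (weight b x) (D b (word_elt \<theta>X w) \<star> gen \<theta>X x)"
    by (simp add: gen_word_elt word_elt_mult D_word_elt deriv_word_append[of b w "[x]"]
        deriv_word_single del: deriv_word.simps)
qed

text \<open>By induction on the word, with \<open>D_mult_gen\<close> on both sides: extending the last code by one letter
  changes neither its weight for the other letter nor whether it can be extended by that letter.\<close>

lemma D_commute:
  assumes bb': "(b, b') \<in> \<theta>" and "f \<in> V"
  shows "D b (D b' f) = D b' (D b f)"
proof (rule klinear_cong_words[OF _ _ assms(2)])
  show "klinear (\<lambda>f. D b (D b' f))" "klinear (\<lambda>f. D b' (D b f))"
    by (rule klinear_comp[OF klinear_D klinear_D])+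
  fix w assume "w \<in> lists X"
  then show "D b (D b' (word_elt \<theta>X w)) = D b' (D b (word_elt \<theta>X w))"
  proof (induction w rule: rev_induct)
    case Nil
    show ?case by (simp add: D_word_elt D_linear)
  next
    case (snoc x w)
    then have w: "w \<in> lists X" and x: "x \<in> X" by auto
    let ?w = "word_elt \<theta>X w :: 'x trace \<Rightarrow>\<^sub>0 'k"
    have V: "?w \<in> V" "D b ?w \<in> V" "D b' ?w \<in> V"
      using w by (auto intro: monoid_algebra_word_elt D_in_V)
    have IH: "D b (D b' ?w) = D b' (D b ?w)" by (rule snoc.IH[OF w])
    have b'b: "(b', b) \<in> \<theta>" using bb' sym_\<theta> by (rule symD[rotated])
    note e = extend_letters[OF bb' x] extend_letters[OF b'b x]
    have "word_elt \<theta>X (w @ [x]) = ?w \<star> gen \<theta>X x" by (simp add: gen_word_elt word_elt_mult)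
    moreover have "D b (D b' (?w \<star> gen \<theta>X x)) = D b' (D b (?w \<star> gen \<theta>X x))"
    proof (cases "extend b x")
      case None
      show ?thesis
      proof (cases "extend b' x")
        case (Some y')
        then show ?thesis
          using None e(2)[OF Some]
          by (simp add: D_mult_gen V D_linear next_gen_def weight_def IH alg_mult_distribs)
      qed (use None in \<open>simp add: D_mult_gen V D_linear next_gen_def weight_def IH alg_mult_distribs\<close>)
    next
      case y: (Some y)
      show ?thesis
      proof (cases "extend b' x")
        case None
        then show ?thesis
          using y e(4)[OF y]
          by (simp add: D_mult_gen V D_linear next_gen_def weight_def IH alg_mult_distribs)
      next
        case y': (Some y')
        then obtain v where "extend b y' = Some v" using e(2)[OF y'] y by (cases "extend b y'") simp_all
        moreover from this have "extend b' y = Some v" using e(1) y y' by simp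
        ultimately show ?thesis
          using y y'
          by (simp add: D_mult_gen V D_linear next_gen_def weight_def IH alg_mult_distribs
              smult.scale_right_distrib)
      qed
    qed
    ultimately show ?case by simp
  qed
qed

definition op :: "'a \<Rightarrow> ('x trace \<Rightarrow>\<^sub>0 'k) \<Rightarrow> ('x trace \<Rightarrow>\<^sub>0 'k)" where
  "op a f = (if a \<in> Z then f \<star> gen \<theta>X (cw a []) else D a f)"

lemma klinear_op: "klinear (op a)"
  by (simp add: klinear_iff op_def D_linear alg_mult_distribs)

lemma gen_cw_in_V: "code_word z bs \<Longrightarrow> gen \<theta>X (cw z bs) \<in> V"
  by (auto simp: gen_word_elt intro!: monoid_algebra_word_elt cw_in_X)

lemma op_in_V: "f \<in> V \<Longrightarrow> op a f \<in> V"
  by (auto simp: op_def intro: monoid_algebra_mult gen_cw_in_V code_word_Nil D_in_V)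

text \<open>The operators satisfy the defining relations of the monoid of traces over \<open>A\<close>. For \<open>z\<close> in \<open>Z\<close> and
  \<open>b\<close> in \<open>B\<close> that commute, the code \<open>z\<close> cannot be extended by \<open>b\<close> and has weight \<open>1\<close>.\<close>

lemma op_commute:
  assumes aa': "(a, a') \<in> \<theta>" and f: "f \<in> V"
  shows "op a (op a' f) = op a' (op a f)"
proof -
  have a'a: "(a', a) \<in> \<theta>" using aa' sym_\<theta> by (rule symD[rotated])
  have mixed: "D b (f \<star> gen \<theta>X (cw z [])) = D b f \<star> gen \<theta>X (cw z [])" if "(z, b) \<in> \<theta>" "z \<in> Z" for b z
    using extend_letter[OF that(2,1)] f
    by (simp add: D_mult_gen next_gen_def weight_def alg_mult_distribs)
  have "(cw a' [], cw a []) \<in> \<theta>X" if "a \<in> Z" "a' \<in> Z"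
    using a'a that by (simp add: cw_\<theta>X_iff code_word_Nil)
  then show ?thesis
    using mixed[OF aa'] mixed[OF a'a] D_commute[OF aa' f] commute_gens
    by (auto simp: op_def alg_mult_trace_assoc)
qed

lemma fold_op_in_V: "f \<in> V \<Longrightarrow> fold op w f \<in> V"
  by (induction w arbitrary: f) (auto intro: op_in_V)

lemma klinear_fold_op: "klinear (fold op w)"
  by (induction w) (auto simp: klinear_iff module_hom.add[OF klinear_op] module_hom.scale[OF klinear_op])

text \<open>The resulting right action; the vector comes first, so that \<open>act_mult\<close> keeps the order of the
  factors.\<close>

definition act :: "('x trace \<Rightarrow>\<^sub>0 'k) \<Rightarrow> ('a trace \<Rightarrow>\<^sub>0 'k) \<Rightarrow> ('x trace \<Rightarrow>\<^sub>0 'k)" where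
  "act f = linear_extension (on_trace (\<lambda>w. fold op w f))"

lemma fold_op_trace:
  assumes "f \<in> V"
  shows "on_trace (\<lambda>w. fold op w f) (trace_of \<theta> w) = fold op w f"
proof (rule on_trace_trace_of)
  fix a b u v assume "(a, b) \<in> \<theta>"
  from op_commute[OF this fold_op_in_V[OF assms]]
  show "fold op (u @ [a, b] @ v) f = fold op (u @ [b, a] @ v) f" by simp
qed

lemma klinear_act: "klinear (act f)"
  unfolding act_def by (rule klinear_linear_extension)

lemma klinear_act_left: "klinear (\<lambda>f. act f g)"
  unfolding act_def on_trace_def by (intro klinear_linear_extension_family klinear_fold_op)

lemma act_word_elt: "f \<in> V \<Longrightarrow> act f (word_elt \<theta> w) = fold op w f"
  by (simp add: act_def word_elt_def linear_extension_single fold_op_trace)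

lemma act_gen: "f \<in> V \<Longrightarrow> act f (gen \<theta> a) = op a f"
  by (simp add: gen_word_elt act_word_elt)

lemma act_mult:
  assumes f: "f \<in> V" and g: "g \<in> monoid_algebra M" and h: "h \<in> monoid_algebra M"
  shows "act f (alg_mult M g h) = act (act f g) h"
proof -
  have "act f (alg_mult M (word_elt \<theta> u) h) = act (act f (word_elt \<theta> u)) h" for u
  proof (rule klinear_cong_words[OF _ klinear_act h])
    show "klinear (\<lambda>h. act f (alg_mult M (word_elt \<theta> u) h))"
      by (rule klinear_comp[OF klinear_act klinear_alg_mult_right])
    show "act f (alg_mult M (word_elt \<theta> u) (word_elt \<theta> v)) = act (act f (word_elt \<theta> u)) (word_elt \<theta> v)" for v
      by (simp add: word_elt_mult act_word_elt f fold_op_in_V)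
  qed
  then show ?thesis
    by (rule klinear_cong_words[where g = "\<lambda>g. act f (alg_mult M g h)" and h = "\<lambda>g. act (act f g) h",
        OF klinear_comp[OF klinear_act klinear_alg_mult_left] klinear_comp[OF klinear_act_left klinear_act] g])
qed

text \<open>For \<open>q = 1\<close> the operators \<open>D b\<close> are derivations, so the commutator of \<open>D b\<close> with the
  multiplication by \<open>y\<close> is the multiplication by \<open>D b y\<close>. Starting from the letter \<open>z\<close>, this turns
  bracketing with \<open>b\<close> into extending the code by \<open>b\<close>.\<close>

lemma act_left_bracket:
  assumes "q = 1" "code_word z bs" "f \<in> V"
  shows "act f (left_bracket \<theta> z bs) = f \<star> gen \<theta>X (cw z bs)"
  using assms(2,3)
proof (induction bs arbitrary: f rule: rev_induct)
  case Nil
  then show ?case by (simp add: left_bracket_Nil act_gen op_def code_word_def)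
next
  case (snoc b bs)
  note c = code_word_butlast[OF snoc.prems(1)]
  have b: "b \<in> B" "b \<notin> Z" using snoc.prems(1) disjoint by (auto simp: code_word_def)
  let ?t = "left_bracket \<theta> z bs :: _ \<Rightarrow>\<^sub>0 'k" and ?b = "gen \<theta> b :: _ \<Rightarrow>\<^sub>0 'k"
  have M: "?t \<in> monoid_algebra M" "?b \<in> monoid_algebra M"
    using code_word_set[OF c] b A_eq
    by (auto simp: gen_word_elt intro!: left_bracket_in_algebra monoid_algebra_word_elt)
  have weight: "weight b (cw z bs) = 1" unfolding weight_def using assms(1) by simp
  have "act f (left_bracket \<theta> z (bs @ [b])) = act (act f ?t) ?b - act (act f ?b) ?t"
    unfolding left_bracket_snoc[where A = A] bracket_def
    by (simp add: module_hom.diff[OF klinear_act] act_mult M snoc.prems)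
  also have "\<dots> = D b (f \<star> gen \<theta>X (cw z bs)) - D b f \<star> gen \<theta>X (cw z bs)"
    using snoc.IH[OF c] snoc.prems b
    by (simp add: act_gen op_def D_in_V monoid_algebra_mult gen_cw_in_V[OF c])
  also have "\<dots> = f \<star> gen \<theta>X (cw z (bs @ [b]))"
    using snoc.prems weight by (simp add: D_mult_gen next_gen_def extend_cw[OF c])
  finally show ?case .
qed

text \<open>For \<open>q = 0\<close> the operator of \<open>b\<close> cannot pass a code that it extends. So the letters of a code word
  build up one code at the end, without touching anything to its left.\<close>

lemma fold_op_code_word:
  assumes "q = 0" "code_word z bs" "f \<in> V"
  shows "fold op (z # bs) f = f \<star> gen \<theta>X (cw z bs)"
  using assms(2,3)
proof (induction bs arbitrary: f rule: rev_induct)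
  case Nil
  then show ?case by (simp add: op_def code_word_def)
next
  case (snoc b bs)
  note c = code_word_butlast[OF snoc.prems(1)]
  have b: "b \<notin> Z" using snoc.prems(1) disjoint by (auto simp: code_word_def)
  have weight: "weight b (cw z bs) = 0"
    unfolding weight_def using snoc.prems(1) assms(1) by (simp add: extend_cw[OF c])
  have "fold op (z # bs @ [b]) f = op b (fold op (z # bs) f)" by simp
  also have "\<dots> = D b (f \<star> gen \<theta>X (cw z bs))"
    unfolding snoc.IH[OF c snoc.prems(2)] using b by (simp add: op_def)
  also have "\<dots> = f \<star> gen \<theta>X (cw z (bs @ [b]))"
    using snoc.prems weight by (simp add: D_mult_gen next_gen_def extend_cw[OF c] alg_mult_distribs)
  finally show ?case .
qed

end

section \<open>Partially commutative codes\<close>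

lemma monoid_prod_list_Cons: "monoid_prod_list G (x # xs) = x \<otimes>\<^bsub>G\<^esub> monoid_prod_list G xs"
  by (simp add: monoid_prod_list_def)

lemma monoid_prod_list_words:
  "monoid_prod_list (trace_monoid A \<theta>) (map (trace_of \<theta>) ws) = trace_of \<theta> (concat ws)"
  by (induction ws) (auto simp: monoid_prod_list_def one_trace_monoid trace_mult)

lemma lists_traces:
  assumes "X \<subseteq> carrier (trace_monoid A \<theta>)" "xs \<in> lists X"
  obtains ws where "xs = map (trace_of \<theta>) ws" "concat ws \<in> lists A"
proof -
  have "\<exists>ws. xs = map (trace_of \<theta>) ws \<and> concat ws \<in> lists A"
    using assms(2)
  proof (induction xs)
    case (Cons x xs)
    then obtain ws where ws: "xs = map (trace_of \<theta>) ws" "concat ws \<in> lists A" by auto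
    from Cons assms(1) obtain w where "x = trace_of \<theta> w" "w \<in> lists A"
      by (auto simp: carrier_trace_monoid)
    with ws have "x # xs = map (trace_of \<theta>) (w # ws)" "concat (w # ws) \<in> lists A" by auto
    then show ?case by (intro exI[of _ "w # ws"] conjI)
  qed simp
  with that show thesis by blast
qed

lemma monoid_prod_list_append:
  assumes "X \<subseteq> carrier (trace_monoid A \<theta>)" "xs \<in> lists X" "ys \<in> lists X"
  shows "monoid_prod_list (trace_monoid A \<theta>) (xs @ ys) =
    monoid_prod_list (trace_monoid A \<theta>) xs \<otimes>\<^bsub>trace_monoid A \<theta>\<^esub> monoid_prod_list (trace_monoid A \<theta>) ys"
proof -
  from assms(2) obtain us where "xs = map (trace_of \<theta>) us" by (rule lists_traces[OF assms(1)])
  moreover from assms(3) obtain vs where "ys = map (trace_of \<theta>) vs" by (rule lists_traces[OF assms(1)])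
  ultimately show ?thesis
    by (simp add: monoid_prod_list_words trace_mult flip: map_append)
qed

text \<open>The product of a word over \<open>X\<close> is unchanged if neighbours with commuting alphabets are swapped, so
  the natural morphism can be computed on any representative.\<close>

lemma natural_morphism_trace_of:
  assumes X: "X \<subseteq> carrier (trace_monoid A \<theta>)"
  shows "natural_morphism (trace_monoid A \<theta>) (trace_of (theta_on \<theta> X) xs)
    = monoid_prod_list (trace_monoid A \<theta>) xs"
proof -
  let ?M = "trace_monoid A \<theta>"
  have swap: "monoid_prod_list ?M (us @ [x, y] @ vs) = monoid_prod_list ?M (us @ [y, x] @ vs)"
    if xy: "(x, y) \<in> theta_on \<theta> X" for x y us vs
  proof -
    from xy have "x \<in> X" "y \<in> X" and Alph: "Alph x \<times> Alph y \<subseteq> \<theta>" by (auto simp: theta_on_def)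
    with X have "x \<in> trace_of \<theta> ` lists A" "y \<in> trace_of \<theta> ` lists A"
      unfolding carrier_trace_monoid by blast+
    then obtain u v where uv: "x = trace_of \<theta> u" "y = trace_of \<theta> v" by blast
    then have "trace_eq \<theta> (u @ v) (v @ u)"
      using Alph by (intro trace_eq_commute) (simp add: Alph_trace_of)
    then have "x \<otimes>\<^bsub>?M\<^esub> y = y \<otimes>\<^bsub>?M\<^esub> x" by (simp add: uv trace_mult trace_of_eq_iff)
    then have "x \<otimes>\<^bsub>?M\<^esub> (y \<otimes>\<^bsub>?M\<^esub> m) = y \<otimes>\<^bsub>?M\<^esub> (x \<otimes>\<^bsub>?M\<^esub> m)" for m
      using trace_mult_assoc[where s = x and t = y and r = m and A = A and \<theta> = \<theta>]
        trace_mult_assoc[where s = y and t = x and r = m and A = A and \<theta> = \<theta>] by simp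
    then show ?thesis by (simp add: monoid_prod_list_def)
  qed
  have "monoid_prod_list ?M ys = monoid_prod_list ?M xs" if "ys \<in> trace_of (theta_on \<theta> X) xs" for ys
  proof -
    have "trace_eq (theta_on \<theta> X) xs ys" using that by (simp add: mem_trace_of)
    then have "monoid_prod_list ?M xs = monoid_prod_list ?M ys"
      by (rule invariant_if_swap_invariant) (rule swap)
    then show ?thesis ..
  qed
  then have "monoid_prod_list ?M ` trace_of (theta_on \<theta> X) xs = {monoid_prod_list ?M xs}"
    using self_mem_trace_of[of xs "theta_on \<theta> X"] by blast
  then show ?thesis by (simp add: natural_morphism_def)
qed

lemma submonoid_gen_eq:
  assumes X: "X \<subseteq> carrier (trace_monoid A \<theta>)"
  shows "submonoid_gen (trace_monoid A \<theta>) X = monoid_prod_list (trace_monoid A \<theta>) ` lists X"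
proof
  let ?M = "trace_monoid A \<theta>"
  have "submonoid (monoid_prod_list ?M ` lists X) ?M"
  proof
    show "monoid_prod_list ?M ` lists X \<subseteq> carrier ?M"
    proof
      fix m assume "m \<in> monoid_prod_list ?M ` lists X"
      then obtain xs where "xs \<in> lists X" "m = monoid_prod_list ?M xs" by blast
      moreover from this(1) obtain ws where "xs = map (trace_of \<theta>) ws" "concat ws \<in> lists A"
        by (rule lists_traces[OF X])
      ultimately show "m \<in> carrier ?M"
        by (simp only: monoid_prod_list_words carrier_trace_monoid imageI)
    qed
    show "\<one>\<^bsub>?M\<^esub> \<in> monoid_prod_list ?M ` lists X"
      by (rule image_eqI[of _ _ "[]"]) (simp_all add: monoid_prod_list_def)
  next
    fix m n assume "m \<in> monoid_prod_list ?M ` lists X" "n \<in> monoid_prod_list ?M ` lists X"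
    then obtain xs ys where "xs \<in> lists X" "ys \<in> lists X"
      "m = monoid_prod_list ?M xs" "n = monoid_prod_list ?M ys" by blast
    then show "m \<otimes>\<^bsub>?M\<^esub> n \<in> monoid_prod_list ?M ` lists X"
      by (intro image_eqI[of _ _ "xs @ ys"]) (simp_all add: monoid_prod_list_append[OF X])
  qed
  moreover have "X \<subseteq> monoid_prod_list ?M ` lists X"
  proof
    fix x assume "x \<in> X"
    with X obtain w where "x = trace_of \<theta> w" by (auto simp: carrier_trace_monoid)
    then have "x = monoid_prod_list ?M [x]" using monoid_prod_list_words[of A \<theta> "[w]"] by simp
    then show "x \<in> monoid_prod_list ?M ` lists X" using \<open>x \<in> X\<close> by (intro image_eqI) auto
  qed
  ultimately show "submonoid_gen ?M X \<subseteq> monoid_prod_list ?M ` lists X"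
    unfolding submonoid_gen_def by (rule hull_minimal[rotated])
  have "monoid_prod_list ?M xs \<in> H" if H: "submonoid H ?M" "X \<subseteq> H" and "xs \<in> lists X" for H xs
    using that(3)
  proof (induction xs)
    case Nil
    show ?case using submonoid.one_closed[OF H(1)] by (simp add: monoid_prod_list_def)
  next
    case (Cons x xs)
    then show ?case
      using H(2) unfolding monoid_prod_list_Cons by (intro submonoid.m_closed[OF H(1)]) auto
  qed
  then show "monoid_prod_list ?M ` lists X \<subseteq> submonoid_gen ?M X"
    unfolding submonoid_gen_def hull_def by blast
qed

text \<open>The natural morphism is always a surjective homomorphism onto the generated submonoid; what
  characterizes codes is its injectivity.\<close>

lemma pc_code_iff:
  assumes X: "X \<subseteq> carrier (trace_monoid A \<theta>)"
  shows "pc_code A \<theta> X \<longleftrightarrow>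
    (\<forall>xs\<in>lists X. \<forall>ys\<in>lists X.
        monoid_prod_list (trace_monoid A \<theta>) xs = monoid_prod_list (trace_monoid A \<theta>) ys
        \<longrightarrow> trace_eq (theta_on \<theta> X) xs ys)" (is "_ = ?R")
proof -
  let ?M = "trace_monoid A \<theta>" and ?N = "trace_monoid X (theta_on \<theta> X)"
  let ?h = "natural_morphism ?M"
  note h = natural_morphism_trace_of[OF X]
  have image: "?h ` carrier ?N = submonoid_gen ?M X"
    by (simp add: carrier_trace_monoid submonoid_gen_eq[OF X] image_image h)
  have "?h (c \<otimes>\<^bsub>?N\<^esub> d) = ?h c \<otimes>\<^bsub>?M\<^esub> ?h d" if cd: "c \<in> carrier ?N" "d \<in> carrier ?N" for c d
  proof -
    from cd obtain xs ys where "xs \<in> lists X" "ys \<in> lists X"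
      "c = trace_of (theta_on \<theta> X) xs" "d = trace_of (theta_on \<theta> X) ys"
      unfolding carrier_trace_monoid by blast
    then show ?thesis by (simp add: trace_mult h monoid_prod_list_append[OF X])
  qed
  then have "?h \<in> hom ?N (?M\<lparr>carrier := submonoid_gen ?M X\<rparr>)"
    using image by (auto simp: hom_def)
  moreover have "inj_on ?h (carrier ?N) \<longleftrightarrow> ?R"
    by (simp add: inj_on_def carrier_trace_monoid h trace_of_eq_iff)
  ultimately show ?thesis
    using X image by (simp add: pc_code_def iso_def bij_betw_def)
qed

context partitioned_alphabet
begin

lemma beta_eq: "\<beta> = {trace_of \<theta> (z # bs) | z bs. code_word z bs}"
  using betaE code_word_beta by blast

lemma beta_carrier: "\<beta> \<subseteq> carrier M"
  unfolding beta_eq carrier_trace_monoid using code_word_set by blast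

lemma not_trace_eq_if_commuting:
  assumes "set (z # bs) \<times> set (z' # bs') \<subseteq> \<theta>"
  shows "\<not> trace_eq \<theta> (z # bs) (z' # bs')"
proof
  assume "trace_eq \<theta> (z # bs) (z' # bs')"
  then have "z \<in> set (z' # bs')" by (metis trace_eq_set list.set_intros(1))
  then have "(z, z) \<in> set (z # bs) \<times> set (z' # bs')" by (intro SigmaI) simp_all
  with assms have "(z, z) \<in> \<theta>" by (rule subsetD)
  then show False using irrefl_\<theta> by blast
qed

lemma TFSA_eq: "TFSA A \<theta> B \<longleftrightarrow> pc_code A \<theta> \<beta>"
proof -
  have "A - B = Z" using A_eq disjoint by blast
  then show ?thesis using B_subset_A by (simp add: TFSA_def)
qed

text \<open>If commuting codes \<open>x\<close>, \<open>y\<close> were both extendable by \<open>b\<close>, then the trace \<open>x \<cdot> yb = y \<cdot> xb\<close> would have two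
  factorizations that consist of different codes.\<close>

lemma no_common_extension_if_TFSA:
  assumes "TFSA A \<theta> B"
  shows no_common_extension
  unfolding no_common_extension_def
proof (intro allI impI notI)
  fix z bs z' bs' b
  assume c: "code_word z (bs @ [b])" "code_word z' (bs' @ [b])"
    and commute: "set (z # bs) \<times> set (z' # bs') \<subseteq> \<theta>"
  let ?t = "trace_of \<theta>"
  let ?x = "?t (z # bs)" and ?y = "?t (z' # bs')"
    and ?xb = "?t (z # bs @ [b])" and ?yb = "?t (z' # bs' @ [b])"
  have in_beta: "?x \<in> \<beta>" "?y \<in> \<beta>" "?xb \<in> \<beta>" "?yb \<in> \<beta>"
    using c by (simp_all add: code_word_snoc code_word_beta)
  have "trace_eq \<theta> ((z # bs) @ (z' # bs') @ [b]) ((z' # bs') @ (z # bs) @ [b])"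
    using trace_eq_append_right[OF trace_eq_commute[OF commute], of "[b]"] by simp
  then have "monoid_prod_list M [?x, ?yb] = monoid_prod_list M [?y, ?xb]"
    using monoid_prod_list_words[of A \<theta> "[z # bs, z' # bs' @ [b]]"]
      monoid_prod_list_words[of A \<theta> "[z' # bs', z # bs @ [b]]"]
    by (simp add: trace_of_eq_iff)
  then have "trace_eq (theta_on \<theta> \<beta>) [?x, ?yb] [?y, ?xb]"
    using assms in_beta unfolding TFSA_eq pc_code_iff[OF beta_carrier] by simp
  then have "{#?x, ?yb#} = {#?y, ?xb#}" by (auto dest: trace_eq_mset)
  then have "?x = ?y \<or> ?x = ?xb" by (auto simp: add_eq_conv_ex)
  moreover have "?x \<noteq> ?y"
    using not_trace_eq_if_commuting[OF commute] by (simp add: trace_of_eq_iff)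
  moreover have "?x \<noteq> ?xb"
  proof
    assume "?x = ?xb"
    then have "mset (z # bs) = mset (z # bs @ [b])"
      unfolding trace_of_eq_iff by (rule trace_eq_mset)
    then show False by simp
  qed
  ultimately show False by blast
qed

text \<open>The product of a word of codes acts, for \<open>q = 0\<close>, as the multiplication by this word. Its value on
  \<open>1\<close> is therefore the word itself, as a trace over \<open>\<beta>\<close>, and the product determines this trace. The
  integers serve as ring of coefficients because the statement is about monoids only.\<close>

lemma TFSA_if_no_common_extension:
  assumes no_common_extension
  shows "TFSA A \<theta> B"
proof -
  interpret E: encoded_codes A B Z \<theta> "\<lambda>z bs. trace_of \<theta> (z # bs)" "0 :: int"
    by unfold_locales (simp_all add: trace_of_eq_iff assms)
  have X: "E.X = \<beta>" unfolding E.X_def beta_eq ..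
  have "(x, y) \<in> E.\<theta>X \<longleftrightarrow> (x, y) \<in> theta_on \<theta> \<beta>" for x y
  proof (cases "x \<in> \<beta> \<and> y \<in> \<beta>")
    case True
    then obtain z bs z' bs' where "code_word z bs" "x = trace_of \<theta> (z # bs)"
      "code_word z' bs'" "y = trace_of \<theta> (z' # bs')" unfolding beta_eq by blast
    with True show ?thesis
      using E.cw_\<theta>X_iff[of z bs z' bs']
      by (simp only: theta_on_def Alph_trace_of mem_Collect_eq case_prod_conv simp_thms)
  next
    case False
    then show ?thesis using E.\<theta>X_X[of x y] unfolding X theta_on_def by blast
  qed
  then have \<theta>X: "E.\<theta>X = theta_on \<theta> \<beta>" by (intro equalityI subrelI) simp_all
  have prod: "\<exists>w. monoid_prod_list M xs = trace_of \<theta> w \<and>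
      (\<forall>f\<in>E.V. fold E.op w f = alg_mult E.N f (word_elt E.\<theta>X xs))"
    if "xs \<in> lists \<beta>" for xs
    using that
  proof (induction xs)
    case Nil
    show ?case
      by (intro exI[of _ "[]"])
        (simp add: monoid_prod_list_def one_trace_monoid alg_mult_one_right)
  next
    case (Cons x xs)
    then obtain z bs where x: "code_word z bs" "x = trace_of \<theta> (z # bs)" unfolding beta_eq by auto
    from Cons obtain w where w: "monoid_prod_list M xs = trace_of \<theta> w"
      "\<And>f. f \<in> E.V \<Longrightarrow> fold E.op w f = alg_mult E.N f (word_elt E.\<theta>X xs)" by auto
    have "monoid_prod_list M (x # xs) = trace_of \<theta> (z # bs @ w)"
      by (simp add: monoid_prod_list_Cons w x trace_mult)
    moreover have "fold E.op (z # bs @ w) f = alg_mult E.N f (word_elt E.\<theta>X (x # xs))"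
      if f: "f \<in> E.V" for f
    proof -
      have "fold E.op (z # bs @ w) f = fold E.op w (fold E.op (z # bs) f)" by simp
      also have "\<dots> = alg_mult E.N (alg_mult E.N f (gen E.\<theta>X x)) (word_elt E.\<theta>X xs)"
        unfolding E.fold_op_code_word[OF HOL.refl x(1) f] x(2)[symmetric]
        using w(2) f E.gen_cw_in_V[OF x(1)] by (simp add: monoid_algebra_mult x(2))
      also have "\<dots> = alg_mult E.N f (word_elt E.\<theta>X (x # xs))"
        by (simp add: alg_mult_trace_assoc gen_word_elt word_elt_mult)
      finally show ?thesis .
    qed
    ultimately show ?case by blast
  qed
  have "trace_eq (theta_on \<theta> \<beta>) xs ys"
    if xy: "xs \<in> lists \<beta>" "ys \<in> lists \<beta>" "monoid_prod_list M xs = monoid_prod_list M ys" for xs ys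
  proof -
    let ?one = "word_elt E.\<theta>X [] :: _ \<Rightarrow>\<^sub>0 int"
    have one: "?one \<in> E.V" by (simp add: monoid_algebra_word_elt)
    from prod[OF xy(1)] obtain u where u: "monoid_prod_list M xs = trace_of \<theta> u"
      "fold E.op u ?one = word_elt E.\<theta>X xs" using one by (auto simp: word_elt_mult)
    from prod[OF xy(2)] obtain v where v: "monoid_prod_list M ys = trace_of \<theta> v"
      "fold E.op v ?one = word_elt E.\<theta>X ys" using one by (auto simp: word_elt_mult)
    have "fold E.op u ?one = fold E.op v ?one"
      using xy(3) E.fold_op_trace[OF one, of u] E.fold_op_trace[OF one, of v] u(1) v(1) by simp
    then have "word_elt E.\<theta>X xs = (word_elt E.\<theta>X ys :: _ \<Rightarrow>\<^sub>0 int)" by (simp only: u(2) v(2))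
    then show ?thesis by (simp only: word_elt_eq_iff \<theta>X)
  qed
  then show ?thesis unfolding TFSA_eq pc_code_iff[OF beta_carrier] by blast
qed

section \<open>Leading terms of iterated brackets\<close>

text \<open>By the Jacobi identity, brackets with two commuting letters can be interchanged.\<close>

lemma left_bracket_swap:
  assumes "(b, b') \<in> \<theta>"
  shows "(left_bracket \<theta> z (us @ [b, b'] @ vs) :: _ \<Rightarrow>\<^sub>0 'k::comm_ring_1) = left_bracket \<theta> z (us @ [b', b] @ vs)"
proof -
  let ?br = "bracket (trace_monoid UNIV \<theta>)"
  let ?f = "left_bracket \<theta> z us :: _ \<Rightarrow>\<^sub>0 'k"
  have "?br (gen \<theta> b :: _ \<Rightarrow>\<^sub>0 'k) (gen \<theta> b') = 0"
    using assms by (simp add: bracket_def gen_word_elt word_elt_mult word_elt_eq_iff trace_eq_swap_first)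
  then have "?br (?br ?f (gen \<theta> b)) (gen \<theta> b') = ?br (?br ?f (gen \<theta> b')) (gen \<theta> b)"
    using bracket_derivation[of UNIV \<theta> ?f "gen \<theta> b" "gen \<theta> b'"] by (simp add: bracket_distribs)
  then show ?thesis by (simp add: left_bracket_def)
qed

lemma left_bracket_trace_eq:
  "trace_eq \<theta> bs bs' \<Longrightarrow> left_bracket \<theta> z bs = left_bracket \<theta> z bs'"
  by (erule invariant_if_swap_invariant) (rule left_bracket_swap)

text \<open>No code is in this set, so the component of an iterated bracket outside the span of this set
  can serve as its leading term.\<close>

definition B_headed :: "'a trace set" where
  "B_headed = {trace_of \<theta> (b # w) | b w. b \<in> B}"

lemma B_headed_initial: "trace_of \<theta> w \<in> B_headed \<Longrightarrow> \<exists>b\<in>B. initial \<theta> b w"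
proof -
  assume "trace_of \<theta> w \<in> B_headed"
  then obtain b v where "b \<in> B" "trace_eq \<theta> w (b # v)" by (auto simp: B_headed_def trace_of_eq_iff)
  then show ?thesis using initial_trace_eq[OF sym_\<theta>, of w "b # v" b] by auto
qed

lemma B_headed_mult: "c \<in> B_headed \<Longrightarrow> c \<otimes>\<^bsub>trace_monoid A' \<theta>\<^esub> trace_of \<theta> w \<in> B_headed"
proof -
  assume "c \<in> B_headed"
  then obtain b v where "b \<in> B" "c = trace_of \<theta> (b # v)" unfolding B_headed_def by blast
  then have "c \<otimes>\<^bsub>trace_monoid A' \<theta>\<^esub> trace_of \<theta> w = trace_of \<theta> (b # v @ w)" by (simp add: trace_mult)
  with \<open>b \<in> B\<close> show ?thesis unfolding B_headed_def by blast
qed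

lemma keys_left_bracket_trace:
  "c \<in> Poly_Mapping.keys (left_bracket \<theta> z bs) \<Longrightarrow> \<exists>w. c = trace_of \<theta> w"
  using keys_left_bracket by metis

text \<open>A term of the expansion other than the word itself starts with a letter of \<open>B\<close>: it extends such a
  term on the right, or the last letter has been put in front.\<close>

lemma left_bracket_leading:
  assumes "bs \<in> lists B"
  shows "Poly_Mapping.keys (left_bracket \<theta> z bs - word_elt \<theta> (z # bs) :: _ \<Rightarrow>\<^sub>0 'k::comm_ring_1) \<subseteq> B_headed"
  using assms
proof (induction bs rule: rev_induct)
  case Nil
  show ?case by (simp add: left_bracket_Nil gen_word_elt)
next
  case (snoc b bs)
  let ?f = "left_bracket \<theta> z bs :: _ \<Rightarrow>\<^sub>0 'k" and ?b = "gen \<theta> b :: _ \<Rightarrow>\<^sub>0 'k"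
  let ?r = "?f - word_elt \<theta> (z # bs)"
  have "left_bracket \<theta> z (bs @ [b]) - word_elt \<theta> (z # bs @ [b])
      = alg_mult M ?r ?b - alg_mult M ?b ?f"
    by (simp add: left_bracket_snoc[where A = A] bracket_def alg_mult_distribs gen_word_elt word_elt_mult)
  moreover have "c \<in> B_headed" if c: "c \<in> Poly_Mapping.keys (alg_mult M ?r ?b)" for c
  proof -
    from keys_mult_gen(1)[OF c] obtain u where u: "u \<in> Poly_Mapping.keys ?r" "c = u \<otimes>\<^bsub>M\<^esub> letter \<theta> b"
      by (elim bexE)
    from snoc have "Poly_Mapping.keys ?r \<subseteq> B_headed" by simp
    with u show ?thesis unfolding letter_def using B_headed_mult by blast
  qed
  moreover have "c \<in> B_headed" if c: "c \<in> Poly_Mapping.keys (alg_mult M ?b ?f)" for c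
  proof -
    from keys_mult_gen(2)[OF c] obtain u where "u \<in> Poly_Mapping.keys ?f" "c = letter \<theta> b \<otimes>\<^bsub>M\<^esub> u"
      by (elim bexE)
    moreover from keys_left_bracket_trace[OF this(1)] obtain w where "u = trace_of \<theta> w" ..
    ultimately have "c = trace_of \<theta> (b # w)" by (simp add: trace_mult letter_def)
    with snoc.prems show ?thesis by (auto simp: B_headed_def)
  qed
  ultimately show ?case
    using keys_diff[of "alg_mult M ?r ?b" "alg_mult M ?b ?f"] by auto
qed

lemma lookup_left_bracket:
  assumes "bs \<in> lists B" "trace_of \<theta> w \<notin> B_headed"
  shows "Poly_Mapping.lookup (left_bracket \<theta> z bs) (trace_of \<theta> w) = (if trace_eq \<theta> (z # bs) w then 1 else 0)"
proof -
  have "trace_of \<theta> w \<notin> Poly_Mapping.keys (left_bracket \<theta> z bs - word_elt \<theta> (z # bs))"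
    using left_bracket_leading[OF assms(1)] assms(2) by blast
  then have "Poly_Mapping.lookup (left_bracket \<theta> z bs) (trace_of \<theta> w)
      = Poly_Mapping.lookup (word_elt \<theta> (z # bs)) (trace_of \<theta> w)"
    by (simp add: in_keys_iff lookup_minus)
  then show ?thesis by (simp add: word_elt_def lookup_single when_def trace_of_eq_iff)
qed

lemma code_word_not_B_headed: "code_word z bs \<Longrightarrow> trace_of \<theta> (z # bs) \<notin> B_headed"
  using disjoint unfolding code_word_def by (blast dest: B_headed_initial)

text \<open>The leading term recovers the code from the bracket, and the bracket depends only on the code
  because all representatives start with the same \<open>z\<close> and commuting letters can be interchanged.\<close>

lemma left_bracket_eq_iff:
  assumes "code_word z bs" "code_word z' bs'"
  shows "(left_bracket \<theta> z bs :: _ \<Rightarrow>\<^sub>0 'k::comm_ring_1) = left_bracket \<theta> z' bs' \<longleftrightarrow> trace_eq \<theta> (z # bs) (z' # bs')"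
proof
  assume eq: "(left_bracket \<theta> z bs :: _ \<Rightarrow>\<^sub>0 'k) = left_bracket \<theta> z' bs'"
  have B: "bs \<in> lists B" "bs' \<in> lists B" using assms by (simp_all add: code_word_def)
  have L: "Poly_Mapping.lookup (left_bracket \<theta> y cs :: _ \<Rightarrow>\<^sub>0 'k) (trace_of \<theta> (z' # bs'))
      = (if trace_eq \<theta> (y # cs) (z' # bs') then 1 else 0)" if "cs \<in> lists B" for y cs
    by (rule lookup_left_bracket[OF that code_word_not_B_headed[OF assms(2)]])
  from L[OF B(1), of z] L[OF B(2), of z'] show "trace_eq \<theta> (z # bs) (z' # bs')"
    unfolding eq by (simp add: trace_eq.refl split: if_splits)
next
  assume "trace_eq \<theta> (z # bs) (z' # bs')"
  from code_word_unique[OF assms this] left_bracket_trace_eq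
  show "(left_bracket \<theta> z bs :: _ \<Rightarrow>\<^sub>0 'k) = left_bracket \<theta> z' bs'" by metis
qed

section \<open>Freeness of the ideal\<close>

text \<open>The letters of the free algebra are the iterated brackets themselves, and \<open>\<phi>\<close> is the algebra map that
  is the identity on letters. It is injective because \<open>\<phi> g\<close> acts on \<open>1\<close> with value \<open>g\<close>, and it maps the
  generators of the free partially commutative Lie algebra onto those of \<open>J\<close>.\<close>

lemma is_free_pc_lie_J:
  assumes no_common_extension
  shows "is_free_pc_lie M (J :: ('a trace \<Rightarrow>\<^sub>0 'k::comm_ring_1) set)"
proof -
  interpret E: encoded_codes A B Z \<theta> "left_bracket \<theta> :: 'a \<Rightarrow> 'a list \<Rightarrow> ('a trace \<Rightarrow>\<^sub>0 'k)" "1 :: 'k"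
    by unfold_locales (simp_all add: left_bracket_eq_iff assms)
  have X: "E.X = tau A \<theta> Z B" unfolding E.X_def tau_eq ..
  let ?m = "alg_mult M :: ('a trace \<Rightarrow>\<^sub>0 'k) \<Rightarrow> _" and ?one = "word_elt \<theta> [] :: 'a trace \<Rightarrow>\<^sub>0 'k"
  define p where "p ts = foldr ?m ts ?one" for ts
  define \<phi> where "\<phi> = linear_extension (on_trace p)"
  have one: "?one \<in> monoid_algebra M" by (simp add: monoid_algebra_word_elt)
  have X_algebra: "t \<in> monoid_algebra M" if "t \<in> E.X" for t
    using that tau_in_algebra unfolding X by blast
  have p_Cons: "p (t # ts) = ?m t (p ts)" for t ts by (simp add: p_def)
  have p_in_algebra: "p ts \<in> monoid_algebra M" if "ts \<in> lists E.X" for ts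
    using that by (induction ts) (auto simp: p_def one X_algebra intro: monoid_algebra_mult)
  have p_append: "p (us @ vs) = ?m (p us) (p vs)" if "vs \<in> lists E.X" for us vs
  proof (induction us)
    case Nil
    show ?case using alg_mult_one_left[OF p_in_algebra[OF that]] by (simp add: p_def)
  qed (simp add: p_Cons alg_mult_trace_assoc)
  have p_swap: "p (us @ [s, t] @ vs) = p (us @ [t, s] @ vs)" if st: "(s, t) \<in> E.\<theta>X" for s t us vs
  proof -
    from st obtain z bs z' bs' where "s = left_bracket \<theta> z bs" "t = left_bracket \<theta> z' bs'"
      "set (z # bs) \<times> set (z' # bs') \<subseteq> \<theta>" unfolding E.\<theta>X_def by blast
    then have "bracket M s t = 0" by (simp only: left_bracket_commute)
    then have "?m s t = ?m t s" by (simp add: bracket_def)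
    then have "?m s (?m t f) = ?m t (?m s f)" for f by (simp flip: alg_mult_trace_assoc)
    then show ?thesis by (simp add: p_def)
  qed
  have klinear_\<phi>: "klinear \<phi>" unfolding \<phi>_def by (rule klinear_linear_extension)
  have \<phi>_word: "\<phi> (word_elt E.\<theta>X ts) = p ts" for ts
  proof -
    have "on_trace p (trace_of E.\<theta>X ts) = p ts" by (rule on_trace_trace_of) (rule p_swap)
    then show ?thesis by (simp add: \<phi>_def word_elt_def linear_extension_single)
  qed
  have \<phi>_gen: "\<phi> (gen E.\<theta>X t) = t" if "t \<in> E.X" for t
    unfolding gen_word_elt \<phi>_word by (simp add: p_def alg_mult_one_right[OF X_algebra[OF that]])
  have \<phi>_mult: "\<phi> (alg_mult E.N f g) = ?m (\<phi> f) (\<phi> g)" if fg: "f \<in> E.V" "g \<in> E.V" for f g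
  proof (rule klinear_cong_words[OF _ _ fg(1)])
    show "klinear (\<lambda>f. \<phi> (alg_mult E.N f g))" "klinear (\<lambda>f. ?m (\<phi> f) (\<phi> g))"
      by (rule klinear_comp[OF klinear_\<phi> klinear_alg_mult_left]
          klinear_comp[OF klinear_alg_mult_left klinear_\<phi>])+
    fix us assume "us \<in> lists E.X"
    show "\<phi> (alg_mult E.N (word_elt E.\<theta>X us) g) = ?m (\<phi> (word_elt E.\<theta>X us)) (\<phi> g)"
    proof (rule klinear_cong_words[OF _ _ fg(2)])
      show "klinear (\<lambda>g. \<phi> (alg_mult E.N (word_elt E.\<theta>X us) g))" "klinear (\<lambda>g. ?m (\<phi> (word_elt E.\<theta>X us)) (\<phi> g))"
        by (rule klinear_comp[OF klinear_\<phi> klinear_alg_mult_right]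
            klinear_comp[OF klinear_alg_mult_right klinear_\<phi>])+
      fix vs assume "vs \<in> lists E.X"
      then show "\<phi> (alg_mult E.N (word_elt E.\<theta>X us) (word_elt E.\<theta>X vs))
          = ?m (\<phi> (word_elt E.\<theta>X us)) (\<phi> (word_elt E.\<theta>X vs))"
        by (simp only: word_elt_mult \<phi>_word p_append)
    qed
  qed
  have \<phi>_bracket: "\<phi> (bracket E.N f g) = bracket M (\<phi> f) (\<phi> g)" if "f \<in> E.V" "g \<in> E.V" for f g
    using that by (simp add: bracket_def module_hom.diff[OF klinear_\<phi>] \<phi>_mult)

  have act_p: "E.act f (p ts) = alg_mult E.N f (word_elt E.\<theta>X ts)" if "ts \<in> lists E.X" "f \<in> E.V" for ts f
    using that
  proof (induction ts arbitrary: f rule: list.induct)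
    case Nil
    then show ?case by (simp add: p_def E.act_word_elt alg_mult_one_right)
  next
    case (Cons t ts)
    then obtain z bs where t: "code_word z bs" "t = left_bracket \<theta> z bs" by (auto elim: E.X_cases)
    have "E.act f (p (t # ts)) = E.act (E.act f t) (p ts)"
      using Cons by (simp add: p_Cons E.act_mult X_algebra p_in_algebra)
    also have "E.act f t = alg_mult E.N f (gen E.\<theta>X t)"
      unfolding t(2) by (rule E.act_left_bracket[OF HOL.refl t(1) Cons.prems(2)])
    also have "E.act (alg_mult E.N f (gen E.\<theta>X t)) (p ts)
        = alg_mult E.N (alg_mult E.N f (gen E.\<theta>X t)) (word_elt E.\<theta>X ts)"
      using Cons t E.gen_cw_in_V[OF t(1)] by (intro Cons.IH monoid_algebra_mult) auto
    also have "\<dots> = alg_mult E.N f (word_elt E.\<theta>X (t # ts))"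
      by (simp add: alg_mult_trace_assoc gen_word_elt word_elt_mult)
    finally show ?case .
  qed
  have act_\<phi>: "E.act (word_elt E.\<theta>X []) (\<phi> g) = g" if g: "g \<in> E.V" for g
  proof (rule klinear_cong_words[OF _ smult.module_hom_ident g])
    show "klinear (\<lambda>g. E.act (word_elt E.\<theta>X []) (\<phi> g))"
      by (rule klinear_comp[OF E.klinear_act klinear_\<phi>])
    fix ts assume "ts \<in> lists E.X"
    then show "E.act (word_elt E.\<theta>X []) (\<phi> (word_elt E.\<theta>X ts)) = word_elt E.\<theta>X ts"
      by (simp add: \<phi>_word act_p monoid_algebra_word_elt word_elt_mult)
  qed
  let ?F = "free_pc_lie E.X E.\<theta>X :: (('a trace \<Rightarrow>\<^sub>0 'k) trace \<Rightarrow>\<^sub>0 'k) set"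
  note F = lie_subalgebraD[OF lie_subalgebra_lie_gen[OF gens_in_algebra[of E.X E.X E.\<theta>X, OF order_refl]],
      folded free_pc_lie_def]
  note \<phi>_add = module_hom.add[OF klinear_\<phi>] and \<phi>_scale = module_hom.scale[OF klinear_\<phi>]
    and \<phi>_zero = module_hom.zero[OF klinear_\<phi>]
  have "inj_on \<phi> ?F"
  proof (rule inj_onI)
    fix f g assume "f \<in> ?F" "g \<in> ?F" "\<phi> f = \<phi> g"
    then show "f = g" using act_\<phi>[OF F(1)] by metis
  qed
  moreover have "\<phi> ` ?F = J"
  proof
    have "\<phi> f \<in> J" if f: "f \<in> ?F" for f
      using f unfolding free_pc_lie_def
    proof (induction rule: lie_gen_induct[OF _ gens_in_algebra[OF order_refl],
          consumes 1, case_names generator zero add scale bracket])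
      case (generator f)
      then show ?case using \<phi>_gen X tau_subset_J by auto
    next
      case (bracket f g)
      then have "\<phi> (bracket E.N f g) = bracket M (\<phi> f) (\<phi> g)"
        by (intro \<phi>_bracket F(1)) (simp_all add: free_pc_lie_def)
      with bracket show ?case by (simp add: J_closed)
    qed (simp_all add: \<phi>_add \<phi>_scale \<phi>_zero J_closed)
    then show "\<phi> ` ?F \<subseteq> J" by blast
    show "J \<subseteq> \<phi> ` ?F"
    proof
      fix x :: "'a trace \<Rightarrow>\<^sub>0 'k" assume "x \<in> J"
      then have "\<exists>f\<in>?F. x = \<phi> f"
      proof (induction rule: J_induct)
        case (generator t)
        then have "t = \<phi> (gen E.\<theta>X t)" using \<phi>_gen X by simp
        moreover have "gen E.\<theta>X t \<in> ?F"
          using generator lie_gen_superset X unfolding free_pc_lie_def by blast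
        ultimately show ?case ..
      next
        case zero
        show ?case using F(2) \<phi>_zero by metis
      next
        case (add x y)
        then show ?case using F(3) \<phi>_add by metis
      next
        case (scale c x)
        then show ?case using F(4) \<phi>_scale by metis
      next
        case (bracket x y)
        then obtain f g where fg: "f \<in> ?F" "g \<in> ?F" "x = \<phi> f" "y = \<phi> g" by blast
        then have "bracket M x y = \<phi> (bracket E.N f g)" by (simp add: \<phi>_bracket F(1))
        then show ?case using F(6)[OF fg(1,2)] by blast
      qed
      then show "x \<in> \<phi> ` ?F" by blast
    qed
  qed
  ultimately have "lie_iso E.N ?F M J \<phi>"
    unfolding lie_iso_def bij_betw_def by (simp add: \<phi>_add \<phi>_scale \<phi>_bracket F(1))
  with E.independence_X show ?thesis unfolding is_free_pc_lie_def by blast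
qed

section \<open>Codes from freeness\<close>

lemma initial_code_word:
  assumes "code_word z bs" "initial \<theta> a (z # bs)" shows "a \<notin> B"
  using assms disjoint unfolding code_word_def by blast

text \<open>With \<open>u\<close> the word of \<open>xb\<close> and \<open>w\<close> the word of \<open>y\<close>, the trace of \<open>w @ u\<close> occurs in the product of the
  brackets in the order \<open>w, u\<close> with coefficient \<open>1\<close>, from the leading terms, and not at all in the
  other product: \<open>b\<close> does not commute with \<open>y\<close>, so it cannot move to the left of \<open>w\<close>. The terms of the
  brackets other than the leading ones start with a letter of \<open>B\<close>, and this rules them out.\<close>

lemma bracket_left_bracket_nonzero:
  assumes c: "code_word z (bs @ [b])" "code_word z' (bs' @ [b])"
    and commute: "set (z # bs) \<times> set (z' # bs') \<subseteq> \<theta>"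
  shows "bracket M (left_bracket \<theta> z (bs @ [b])) (left_bracket \<theta> z' bs') \<noteq> (0 :: 'a trace \<Rightarrow>\<^sub>0 'k::comm_ring_1)"
proof -
  let ?m = "alg_mult M :: ('a trace \<Rightarrow>\<^sub>0 'k) \<Rightarrow> _"
  let ?u = "z # bs @ [b]" and ?w = "z' # bs'"
  define P Q where "P = (left_bracket \<theta> z (bs @ [b]) :: _ \<Rightarrow>\<^sub>0 'k)" and "Q = (left_bracket \<theta> z' bs' :: _ \<Rightarrow>\<^sub>0 'k)"
  define r s where "r = P - word_elt \<theta> ?u" and "s = Q - word_elt \<theta> ?w"
  let ?k = "trace_of \<theta> (?w @ ?u)"
  have w: "code_word z' bs'" using c(2) by (simp add: code_word_snoc)
  have b: "b \<in> B" and "bs @ [b] \<in> lists B" "bs' \<in> lists B"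
    using c by (simp_all add: code_word_def)
  then have r: "Poly_Mapping.keys r \<subseteq> B_headed" and s: "Poly_Mapping.keys s \<subseteq> B_headed"
    unfolding r_def s_def P_def Q_def by (blast intro: subsetD[OF left_bracket_leading])+
  have traces: "\<exists>v. t = trace_of \<theta> v" if "t \<in> Poly_Mapping.keys P \<or> t \<in> Poly_Mapping.keys Q" for t
    using that unfolding P_def Q_def by (blast dest: keys_left_bracket_trace)
  have move: "trace_eq \<theta> (?w @ ?u) ((z # bs) @ ?w @ [b])"
    using trace_eq_append_right[OF trace_eq.sym[OF trace_eq_commute[OF commute]], of "[b]"] by simp
  have "initial \<theta> a (?w @ ?u) \<longleftrightarrow> initial \<theta> a ((z # bs) @ ?w @ [b])" for a
    by (rule initial_trace_eq[OF sym_\<theta> move])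
  have k: "?k \<notin> B_headed"
  proof
    assume "?k \<in> B_headed"
    then obtain a where a: "a \<in> B" "initial \<theta> a (?w @ ?u)" using B_headed_initial by blast
    then have "initial \<theta> a ?w \<or> initial \<theta> a ?u" by (metis initial_append)
    then show False using a(1) initial_code_word[OF c(1)] initial_code_word[OF w] by blast
  qed
  \<comment> \<open>Cancelling \<open>z # bs\<close> would show that \<open>b\<close> can be moved to the front of the code word of \<open>yb\<close>.\<close>
  have not_u: "\<not> trace_eq \<theta> (?u @ v) (?w @ ?u)" for v
  proof
    assume "trace_eq \<theta> (?u @ v) (?w @ ?u)"
    then have "trace_eq \<theta> ((z # bs) @ b # v) ((z # bs) @ ?w @ [b])"
      using trace_eq.trans[OF _ move] by simp
    then have "trace_eq \<theta> (b # v) (?w @ [b])" by (rule trace_eq_cancel_left)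
    then have "initial \<theta> b (z' # bs' @ [b])"
      using initial_trace_eq[OF sym_\<theta>, of "b # v" "?w @ [b]" b] by simp
    then show False using initial_code_word[OF c(2)] b by blast
  qed
  have "?k \<notin> Poly_Mapping.keys (?m (word_elt \<theta> ?u) Q)"
  proof
    assume "?k \<in> Poly_Mapping.keys (?m (word_elt \<theta> ?u) Q)"
    from subsetD[OF keys_alg_mult this] obtain t where t: "t \<in> Poly_Mapping.keys Q"
      "?k = trace_of \<theta> ?u \<otimes>\<^bsub>M\<^esub> t" by (auto simp: word_elt_def)
    with traces obtain v where "t = trace_of \<theta> v" by blast
    with t(2) have "trace_eq \<theta> (?w @ ?u) (?u @ v)" by (simp only: trace_mult trace_of_eq_iff)
    then show False using not_u trace_eq.sym by metis
  qed
  moreover have "?k \<notin> Poly_Mapping.keys (?m f g)"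
    if f: "Poly_Mapping.keys f \<subseteq> B_headed" and g: "g = P \<or> g = Q" for f g
  proof
    assume "?k \<in> Poly_Mapping.keys (?m f g)"
    from subsetD[OF keys_alg_mult this] obtain t t' where t: "t \<in> Poly_Mapping.keys f"
      "t' \<in> Poly_Mapping.keys g" "?k = t \<otimes>\<^bsub>M\<^esub> t'" by blast
    with traces g obtain v where "t' = trace_of \<theta> v" by blast
    then have "?k \<in> B_headed" using t f B_headed_mult by (metis subsetD)
    with k show False by blast
  qed
  note this[OF r, of Q] this[OF s, of P]
  moreover have "?k \<notin> Poly_Mapping.keys (?m (word_elt \<theta> ?w) r)"
  proof
    assume "?k \<in> Poly_Mapping.keys (?m (word_elt \<theta> ?w) r)"
    from subsetD[OF keys_alg_mult this] obtain t where t: "t \<in> Poly_Mapping.keys r"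
      "?k = trace_of \<theta> ?w \<otimes>\<^bsub>M\<^esub> t" by (auto simp: word_elt_def)
    with r obtain a v where a: "a \<in> B" "t = trace_of \<theta> (a # v)" unfolding B_headed_def by blast
    with t(2) have "trace_eq \<theta> (?w @ ?u) (?w @ a # v)" by (simp only: trace_mult trace_of_eq_iff)
    then have "trace_eq \<theta> ?u (a # v)" by (rule trace_eq_cancel_left)
    then have "initial \<theta> a ?u" using initial_trace_eq[OF sym_\<theta>, of ?u "a # v" a] by simp
    then show False using initial_code_word[OF c(1)] a(1) by blast
  qed
  moreover have "?m P Q - ?m Q P = ?m (word_elt \<theta> ?u) Q + ?m r Q
      - (word_elt \<theta> (?w @ ?u) + ?m (word_elt \<theta> ?w) r + ?m s P)"
  proof -
    have "?m P Q = ?m (word_elt \<theta> ?u) Q + ?m r Q" by (simp add: r_def alg_mult_distribs)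
    moreover have "?m Q P = ?m (word_elt \<theta> ?w) P + ?m s P" by (simp add: s_def alg_mult_distribs)
    moreover have "?m (word_elt \<theta> ?w) P = word_elt \<theta> (?w @ ?u) + ?m (word_elt \<theta> ?w) r"
      by (simp add: r_def alg_mult_distribs word_elt_mult)
    ultimately show ?thesis by simp
  qed
  ultimately have "Poly_Mapping.lookup (?m P Q - ?m Q P) ?k = - 1"
    by (simp add: lookup_add lookup_minus in_keys_iff word_elt_def)
  then show ?thesis unfolding P_def Q_def bracket_def by auto
qed

text \<open>Applying the bracket with \<open>b\<close> to \<open>[t\<^sub>x, t\<^sub>y] = 0\<close> gives \<open>[t\<^sub>x\<^sub>b, t\<^sub>y] + [t\<^sub>x, t\<^sub>y\<^sub>b] = 0\<close> in \<open>J\<close>. In the free algebra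
  the two brackets involve different multisets of letters, so they cannot cancel, and the
  letters of \<open>t\<^sub>x\<^sub>b\<close> and \<open>t\<^sub>y\<close> must commute; but the bracket of \<open>t\<^sub>x\<^sub>b\<close> and \<open>t\<^sub>y\<close> is nonzero.\<close>

lemma no_common_extension_if_free_with_code:
  assumes "is_free_pc_lie_with_code M (J :: ('a trace \<Rightarrow>\<^sub>0 'k::comm_ring_1) set) (tau A \<theta> Z B)"
  shows no_common_extension
  unfolding no_common_extension_def
proof (intro allI impI notI)
  fix z bs z' bs' b
  assume c: "code_word z (bs @ [b])" "code_word z' (bs' @ [b])"
    and commute: "set (z # bs) \<times> set (z' # bs') \<subseteq> \<theta>"
  let ?T = "tau A \<theta> Z B :: ('a trace \<Rightarrow>\<^sub>0 'k) set"
  from assms obtain \<theta>' \<phi> where iso: "lie_iso (trace_monoid ?T \<theta>') (free_pc_lie ?T \<theta>') M J \<phi>"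
    and \<phi>_gen: "\<And>t. t \<in> ?T \<Longrightarrow> \<phi> (gen \<theta>' t) = t"
    unfolding is_free_pc_lie_with_code_def by (elim conjE exE) metis
  let ?N = "trace_monoid ?T \<theta>'" and ?F = "free_pc_lie ?T \<theta>' :: (('a trace \<Rightarrow>\<^sub>0 'k) trace \<Rightarrow>\<^sub>0 'k) set"
  define x y xb yb where "x = (left_bracket \<theta> z bs :: _ \<Rightarrow>\<^sub>0 'k)" and "y = (left_bracket \<theta> z' bs' :: _ \<Rightarrow>\<^sub>0 'k)"
    and "xb = (left_bracket \<theta> z (bs @ [b]) :: _ \<Rightarrow>\<^sub>0 'k)" and "yb = (left_bracket \<theta> z' (bs' @ [b]) :: _ \<Rightarrow>\<^sub>0 'k)"
  have c': "code_word z bs" "code_word z' bs'" using c by (simp_all add: code_word_snoc)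
  have T: "x \<in> ?T" "y \<in> ?T" "xb \<in> ?T" "yb \<in> ?T"
    unfolding x_def y_def xb_def yb_def using c c' by (simp_all only: left_bracket_in_tau)
  note F = lie_subalgebraD[OF lie_subalgebra_lie_gen[OF gens_in_algebra[of ?T ?T \<theta>', OF order_refl]],
      folded free_pc_lie_def]
  have gen_F: "gen \<theta>' t \<in> ?F" if "t \<in> ?T" for t
    unfolding free_pc_lie_def using that by (intro subsetD[OF lie_gen_superset] imageI)
  have \<phi>_inj: "inj_on \<phi> ?F"
    and \<phi>_add: "\<And>f g. f \<in> ?F \<Longrightarrow> g \<in> ?F \<Longrightarrow> \<phi> (f + g) = \<phi> f + \<phi> g"
    and \<phi>_lie: "\<And>f g. f \<in> ?F \<Longrightarrow> g \<in> ?F \<Longrightarrow> \<phi> (bracket ?N f g) = bracket M (\<phi> f) (\<phi> g)"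
    using iso unfolding lie_iso_def bij_betw_def by simp_all
  have \<phi>_zero: "\<phi> 0 = 0"
  proof -
    have "\<phi> (0 + 0) = \<phi> 0 + \<phi> 0" by (intro \<phi>_add F(2))
    then show ?thesis by simp
  qed
  have \<phi>_bracket: "\<phi> (bracket ?N (gen \<theta>' s) (gen \<theta>' t)) = bracket M s t" if "s \<in> ?T" "t \<in> ?T" for s t
    using that by (simp add: \<phi>_lie gen_F \<phi>_gen)
  let ?h = "bracket ?N (gen \<theta>' xb) (gen \<theta>' y) :: _ \<Rightarrow>\<^sub>0 'k"
    and ?h' = "bracket ?N (gen \<theta>' x) (gen \<theta>' yb) :: _ \<Rightarrow>\<^sub>0 'k"
  have h_F: "?h \<in> ?F" "?h' \<in> ?F" using T by (simp_all add: F gen_F)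
  have "bracket M x y = 0" unfolding x_def y_def by (rule left_bracket_commute[OF commute])
  moreover have "bracket M (bracket M x y) (gen \<theta> b) = bracket M xb y + bracket M x yb"
    unfolding xb_def yb_def x_def y_def left_bracket_snoc[where A = A] by (rule bracket_derivation)
  ultimately have "bracket M xb y + bracket M x yb = 0" by (simp add: bracket_distribs)
  moreover have "\<phi> (?h + ?h') = \<phi> ?h + \<phi> ?h'" by (intro \<phi>_add h_F)
  ultimately have "\<phi> (?h + ?h') = \<phi> 0" using T by (simp add: \<phi>_bracket \<phi>_zero)
  then have "?h + ?h' = 0" by (rule inj_onD[OF \<phi>_inj]) (intro F(2) F(3)[OF h_F])+
  moreover have "?h + ?h' = word_elt \<theta>' [xb, y] - word_elt \<theta>' [y, xb] + (word_elt \<theta>' [x, yb] - word_elt \<theta>' [yb, x])"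
    by (simp add: bracket_def gen_word_elt word_elt_mult)
  ultimately have "Poly_Mapping.lookup (word_elt \<theta>' [xb, y] - word_elt \<theta>' [y, xb]
      + (word_elt \<theta>' [x, yb] - word_elt \<theta>' [yb, x]) :: _ \<Rightarrow>\<^sub>0 'k) (trace_of \<theta>' [xb, y]) = 0"
    by simp
  moreover have "\<not> trace_eq \<theta>' [x, yb] [xb, y]" "\<not> trace_eq \<theta>' [yb, x] [xb, y]"
  proof -
    have "x \<noteq> y"
      unfolding x_def y_def left_bracket_eq_iff[OF c'] by (rule not_trace_eq_if_commuting[OF commute])
    moreover have "x \<noteq> xb"
      unfolding x_def xb_def left_bracket_eq_iff[OF c'(1) c(1)] by (auto dest: trace_eq_mset)
    ultimately have "{#x, yb#} \<noteq> {#xb, y#}" by (auto simp: add_eq_conv_ex)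
    then show "\<not> trace_eq \<theta>' [x, yb] [xb, y]" "\<not> trace_eq \<theta>' [yb, x] [xb, y]"
      by (auto dest!: trace_eq_mset simp: add_mset_commute[of yb x])
  qed
  \<comment> \<open>The first word has coefficient \<open>1\<close>, which only the second word can compensate.\<close>
  ultimately have "trace_eq \<theta>' [y, xb] [xb, y]"
    by (simp add: lookup_add lookup_minus word_elt_def lookup_single when_def trace_of_eq_iff split: if_splits)
  then have "?h = 0"
    by (simp add: bracket_def gen_word_elt word_elt_mult word_elt_eq_iff trace_eq.sym)
  then have "bracket M xb y = 0" using \<phi>_bracket[OF T(3,2)] \<phi>_zero by simp
  with bracket_left_bracket_nonzero[OF c commute] show False unfolding xb_def y_def by (rule notE)
qed

end

theorem theorem19:
  fixes A B Z :: "'a set" and \<theta> :: "('a \<times> 'a) set"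
    and J :: "('a trace \<Rightarrow>\<^sub>0 'k::comm_ring_1) set"
  assumes "independence_alphabet A \<theta>"
    and "A = B \<union> Z" and "B \<inter> Z = {}"
    and J_def: "J = lie_gen (trace_monoid A \<theta>) (tau A \<theta> Z B)"
  shows "(lie_ideal (trace_monoid A \<theta>) (free_pc_lie A \<theta>) J \<and>
          direct_sum (free_pc_lie A \<theta>) (lie_gen (trace_monoid A \<theta>) (gen \<theta> ` B)) J) \<and>
         (TFSA A \<theta> B \<longrightarrow> is_free_pc_lie (trace_monoid A \<theta>) J) \<and>
         (is_free_pc_lie_with_code (trace_monoid A \<theta>) J (tau A \<theta> Z B) \<longrightarrow> TFSA A \<theta> B)"
proof -
  interpret P: partitioned_alphabet A B Z \<theta> by unfold_locales (fact assms)+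
  have J: "J = P.J" unfolding J_def P.J_def ..
  show ?thesis
    unfolding J
    using P.lie_ideal_J P.direct_sum_L P.is_free_pc_lie_J P.no_common_extension_if_TFSA
      P.no_common_extension_if_free_with_code P.TFSA_if_no_common_extension by blast
qed

end
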